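(* For any choice of $\sigma=\sigma(n)\in\{-1,+1\}^n$ (one spin configuration for each $n$), $$\lim_{n\to+\infty}\frac1n\log \mathbb{P}\{\sigma \text{ is locally optimal}\}=\alpha^*-\log 2 .$$ Moreover, there exist constants $\epsilon_0>0$, $L>0$ and $n_0$ such that, for all $0<\epsilon<\epsilon_0$, all $n\ge n_0$ and all $\sigma\in\{-1,+1\}^n$, $$\mathbb{P}\left\{\left. -\frac{v^*}{2}-\epsilon\le n^{-3/2}H(\sigma)\le -\frac{v^*}{2}+\epsilon\ \right|\ \sigma\text{ is locally optimal}\right\}\ge 1-\exp\left(L\sqrt n-\epsilon^2 n\right).$$
   Context: Let $W=(W_{i,j})_{n\times n}$ be a random symmetric matrix with zero diagonal such that $(W_{i,j})_{1\le i<j\le n}$ are independent standard normal random variables. For $\sigma=(\sigma_1,\dots,\sigma_n)\in\{-1,+1\}^n$ (a spin configuration), the Sherrington-Kirkpatrick Hamiltonian is $H(\sigma)=\sum_{1\le i<j\le n}\sigma_i\sigma_jW_{i,j}$. For $i\in[n]=\{1,\dots,n\}$, $\sigma^{(i)}$ denotes the configuration obtained from $\sigma$ by flipping the sign of the $i$-th coordinate and leaving the other coordinates unchanged. The configuration $\sigma$ is called locally optimal (a local minimum, a local optimum) if $H(\sigma^{(i)})\ge H(\sigma)$ for all $i\in[n]$. Let $\Phi$ be the distribution function of a standard normal random variable and $\phi(\lambda)=\log(2\Phi(\lambda))$. For $x\ge\sqrt{2/\pi}$ let $$\mu^*(x)=\sup_{\lambda\ge 0}\left(\lambda x-\frac{\lambda^2}{2}-\phi(\lambda)\right),\qquad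 R(x)=\frac{x^2}{4}-\mu^*(x).$$ The function $R$ on $[\sqrt{2/\pi},+\infty)$ is strictly concave and achieves its global maximum at a (unique) point, denoted $v^*$, which satisfies $v^*>\sqrt{2/\pi}$; the maximum value is denoted $\alpha^*=R(v^* )>0$. Here $\log$ is the natural logarithm. *)

theory Defs
  imports "HOL-Probability.Probability"
begin

definition index_pairs :: "nat \<Rightarrow> (nat \<times> nat) set" where
  "index_pairs n = {(i, j). 1 \<le> i \<and> i < j \<and> j \<le> n}"

text \<open>Matrices are functions of two indices of which only the values on \<open>{1..n} \<times> {1..n}\<close> matter;
  likewise a spin configuration is constrained on \<open>{1..n}\<close> only.\<close>

definition sk_disorder ::
    "'a measure \<Rightarrow> nat \<Rightarrow> (nat \<Rightarrow> nat \<Rightarrow> 'a \<Rightarrow> real) \<Rightarrow> bool" where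
  "sk_disorder M n W \<longleftrightarrow>
     prob_space M \<and>
     (\<forall>i\<in>{1..n}. \<forall>j\<in>{1..n}. \<forall>\<omega>\<in>space M. W i j \<omega> = W j i \<omega>) \<and>
     (\<forall>i\<in>{1..n}. \<forall>\<omega>\<in>space M. W i i \<omega> = 0) \<and>
     (\<forall>(i, j)\<in>index_pairs n. distributed M lborel (W i j) std_normal_density) \<and>
     prob_space.indep_vars M (\<lambda>_. borel) (\<lambda>(i, j). W i j) (index_pairs n)"

definition spin_configs :: "nat \<Rightarrow> (nat \<Rightarrow> real) set" where
  "spin_configs n = {1..n} \<rightarrow> {-1, 1}"

definition hamiltonian :: "nat \<Rightarrow> (nat \<Rightarrow> nat \<Rightarrow> real) \<Rightarrow> (nat \<Rightarrow> real) \<Rightarrow> real" where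
  "hamiltonian n w \<sigma> = (\<Sum>(i, j)\<in>index_pairs n. \<sigma> i * \<sigma> j * w i j)"

definition flip :: "nat \<Rightarrow> (nat \<Rightarrow> real) \<Rightarrow> (nat \<Rightarrow> real)" where
  "flip i \<sigma> = \<sigma>(i := - \<sigma> i)"

definition locally_optimal :: "nat \<Rightarrow> (nat \<Rightarrow> nat \<Rightarrow> real) \<Rightarrow> (nat \<Rightarrow> real) \<Rightarrow> bool" where
  "locally_optimal n w \<sigma> \<longleftrightarrow> (\<forall>i\<in>{1..n}. hamiltonian n w (flip i \<sigma>) \<ge> hamiltonian n w \<sigma>)"

definition Phi :: "real \<Rightarrow> real" where
  "Phi = cdf std_normal_distribution"

definition phi :: "real \<Rightarrow> real" where
  "phi l = ln (2 * Phi l)"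

definition mu_star :: "real \<Rightarrow> real" where
  "mu_star x = (SUP l\<in>{0..}. l * x - l\<^sup>2 / 2 - phi l)"

text \<open>Only the values at \<open>x \<ge> sqrt (2 / pi)\<close> are relevant for \<open>R\<close>; its maximiser over this
  half-line is unique because \<open>R\<close> is strictly concave there.\<close>

definition R :: "real \<Rightarrow> real" where
  "R x = x\<^sup>2 / 4 - mu_star x"

definition v_star :: real where
  "v_star = (THE v. is_arg_max R (\<lambda>x. x \<ge> sqrt (2 / pi)) v)"

definition alpha_star :: real where
  "alpha_star = R v_star"

end

(*
For fixed \<sigma>, flipping spin k changes H by 2 V_k, where the local fields V_k are centred Gaussian
with covariance (n - 2) I + 1 1^T, and the V_k sum to -2 H.  Hence V has the law of (a Y_k + Y_0) with
a = sqrt (n - 2) and independent standard normals Y_0, ..., Y_n.  With \<lambda> = Y_0 / a,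

  E [exp ((t/a) \<Sum> V_k); V \<ge> 0] = E [(exp (t \<lambda> + t^2/2) Phi (\<lambda> + t))^n].

Since Phi is log-concave it lies below the exponential tangent Phi l * exp (l (x - l)) at the fixed
point l of the ratio density / Phi; this makes the outer expectation an explicit Gaussian integral,
of size exp (n (ln (Phi l) - l^2/2 + 2 l t + t^2)) up to a constant factor.  Taking t = 0 bounds the
probability of local optimality, and t = \<epsilon> or -\<epsilon> gives by Chebyshev the two tails of H.
The matching lower bound comes from Y_0 in [a l, a l + 1], at the price of a factor exp (- l sqrt n).
Finally v* = 2 l, and alpha* - ln 2 = ln (Phi l) - l^2/2.
*)

theory Submission
  imports Defs "HOL-Real_Asymp.Real_Asymp"
begin

section \<open>The standard normal distribution function\<close>

text \<open>Why a fixed point: given \<lambda>, all fields are nonnegative with probability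
  \<open>Phi \<lambda> ^ n\<close>, while \<lambda> has density of order exp (- n \<lambda>^2 / 2).
  The exponent ln (Phi \<lambda>) - \<lambda>^2 / 2 is critical exactly where the density /
  \<open>Phi\<close> ratio equals \<lambda>, so there the tangent loses nothing at exponential
  scale. Why this agrees with \<open>R\<close>: a standard normal N satisfies E exp (\<lambda> |N|)
  = 2 exp (\<lambda>^2 / 2) Phi \<lambda>, so \<open>mu_star\<close> is the Cramer rate function of
  |N| and sqrt (2 / pi) is the mean of |N|. Inserting \<lambda> = x / 2 into the supremum turns R x
  into a bound of the form above. The obstacle is the passage from the disorder to the explicit
  model: equal covariances help only once Gaussian vectors with equal covariance are known to have
  equal laws. This is settled by a uniqueness theorem for characteristic functions in finite
  dimension, proved by Gaussian smoothing of orthant indicators. All errors are bounded factors,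
  apart from the exp (l sqrt n) lost in the lower bound; this is the source of L sqrt n in the
  conditional estimate.\<close>

lemma nn_integral_std_normal_exp_shift:
  assumes [measurable]: "f \<in> borel_measurable borel"
  shows "(\<integral>\<^sup>+y. ennreal (exp (t * y)) * f y \<partial>std_normal_distribution) =
    ennreal (exp (t\<^sup>2 / 2)) * (\<integral>\<^sup>+y. f (y + t) \<partial>std_normal_distribution)"
proof -
  have e: "ennreal (std_normal_density y) * (ennreal (exp (t * y)) * f y) =
      ennreal (exp (t\<^sup>2 / 2)) * (ennreal (std_normal_density (y - t)) * f y)" for y
  proof -
    have "std_normal_density y * exp (t * y) = exp (t\<^sup>2 / 2) * std_normal_density (y - t)"
      by (simp add: std_normal_density_def exp_add[symmetric] field_simps power2_eq_square)
    then show ?thesis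
      by (simp add: ennreal_mult'[symmetric] mult.assoc[symmetric])
  qed
  have "(\<integral>\<^sup>+y. ennreal (exp (t * y)) * f y \<partial>std_normal_distribution) =
      (\<integral>\<^sup>+y. ennreal (exp (t\<^sup>2 / 2)) * (ennreal (std_normal_density (y - t)) * f y) \<partial>lborel)"
    by (subst nn_integral_density) (auto simp: e)
  also have "\<dots> = ennreal (exp (t\<^sup>2 / 2)) * (\<integral>\<^sup>+y. ennreal (std_normal_density (y - t)) * f y \<partial>lborel)"
    by (subst nn_integral_cmult) auto
  also have "(\<integral>\<^sup>+y. ennreal (std_normal_density (y - t)) * f y \<partial>lborel) =
      (\<integral>\<^sup>+y. ennreal (std_normal_density y) * f (y + t) \<partial>lborel)"
    using nn_integral_real_affine[of "\<lambda>y. ennreal (std_normal_density (y - t)) * f y" 1 t]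
    by (simp add: add.commute)
  also have "\<dots> = (\<integral>\<^sup>+y. f (y + t) \<partial>std_normal_distribution)"
    by (subst nn_integral_density) auto
  finally show ?thesis .
qed

interpretation std_normal: real_distribution std_normal_distribution
  by (rule real_dist_normal_dist)

lemma emeasure_std_normal_singleton: "emeasure std_normal_distribution {x} = 0"
proof -
  have "emeasure std_normal_distribution {x} =
      (\<integral>\<^sup>+y. ennreal (std_normal_density y) * indicator {x} y \<partial>lborel)"
    by (subst emeasure_density) auto
  also have "\<dots> = (\<integral>\<^sup>+y. 0 \<partial>(lborel :: real measure))"
    using AE_lborel_singleton[of x] by (intro nn_integral_cong_AE) (auto elim: eventually_mono)
  finally show ?thesis by simp
qed

lemma nn_integral_std_normal_exp:
  "(\<integral>\<^sup>+y. ennreal (exp (t * y)) \<partial>std_normal_distribution) = ennreal (exp (t\<^sup>2 / 2))"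
  using nn_integral_std_normal_exp_shift[of "\<lambda>_. 1" t] std_normal.emeasure_space_1 by simp

lemma emeasure_std_normal_atMost: "emeasure std_normal_distribution {..x} = ennreal (Phi x)"
  by (simp add: Phi_def cdf_def std_normal.emeasure_eq_measure)

lemma emeasure_std_normal_atLeast: "emeasure std_normal_distribution {x..} = ennreal (Phi (- x))"
proof -
  have "emeasure std_normal_distribution {x..} = (\<integral>\<^sup>+y. ennreal (std_normal_density y) * indicator {x..} y \<partial>lborel)"
    by (subst emeasure_density) auto
  also have "\<dots> = (\<integral>\<^sup>+y. ennreal (std_normal_density (- y)) * indicator {x..} (- y) \<partial>lborel)"
    using nn_integral_real_affine[of "\<lambda>y. ennreal (std_normal_density y) * indicator {x..} y" "-1" 0]
    by simp
  also have "\<dots> = (\<integral>\<^sup>+y. ennreal (std_normal_density y) * indicator {..-x} y \<partial>lborel)"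
    by (intro nn_integral_cong) (auto simp: std_normal_density_def indicator_def)
  also have "\<dots> = ennreal (Phi (-x))"
    by (subst emeasure_density[symmetric]) (auto simp: emeasure_std_normal_atMost)
  finally show ?thesis .
qed

lemma Phi_nonneg: "0 \<le> Phi x" and Phi_le_1: "Phi x \<le> 1"
  by (simp_all add: Phi_def cdf_def)

lemma Phi_mono: "x \<le> y \<Longrightarrow> Phi x \<le> Phi y"
  unfolding Phi_def cdf_def by (intro std_normal.finite_measure_mono) auto

text \<open>The exponential tilt moves the mean to \<open>t\<close>, so the half-line is seen from
  the shifted centre.\<close>

lemma nn_integral_std_normal_exp_atLeast:
  "(\<integral>\<^sup>+y. ennreal (exp (t * y)) * indicator {- l..} y \<partial>std_normal_distribution) =
    ennreal (exp (t\<^sup>2 / 2) * Phi (l + t))"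
proof -
  have "(\<integral>\<^sup>+y. indicator {- l..} (y + t) \<partial>std_normal_distribution) =
      (\<integral>\<^sup>+y. indicator {- l - t..} y \<partial>std_normal_distribution)"
    by (intro nn_integral_cong) (auto simp: indicator_def)
  also have "\<dots> = ennreal (Phi (l + t))"
    by (subst nn_integral_indicator) (auto simp: emeasure_std_normal_atLeast algebra_simps)
  finally show ?thesis
    by (subst nn_integral_std_normal_exp_shift) (auto simp: ennreal_mult Phi_nonneg)
qed

lemma Phi_0: "Phi 0 = 1 / 2"
proof -
  have "emeasure std_normal_distribution ({..0} \<union> {0..}) = 
     emeasure std_normal_distribution {..0} + emeasure std_normal_distribution {0..}"
  proof (rule emeasure_Un')
    have "({..0} \<inter> {0..}) = {0::real}" by auto
    moreover have "{0::real} \<in> null_sets std_normal_distribution"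
      by (rule null_setsI[OF emeasure_std_normal_singleton]) simp
    ultimately show "{..0} \<inter> {0..} \<in> null_sets std_normal_distribution"
      by metis
  qed auto
  moreover have "{..0} \<union> {0..} = (UNIV :: real set)" by auto
  ultimately have "ennreal 1 = ennreal (Phi 0) + ennreal (Phi 0)"
    using std_normal.emeasure_space_1
    by (simp add: emeasure_std_normal_atMost emeasure_std_normal_atLeast)
  also have "ennreal (Phi 0) + ennreal (Phi 0) = ennreal (Phi 0 + Phi 0)"
    by (rule ennreal_plus[symmetric]) (rule Phi_nonneg)+
  finally have "ennreal 1 = ennreal (Phi 0 + Phi 0)"
    by simp
  then have "1 = Phi 0 + Phi 0"
    by (subst (asm) ennreal_inj) (auto simp del: ennreal_plus simp: Phi_nonneg)
  then show ?thesis by simp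
qed

lemma Phi_add_integral:
  assumes "a \<le> x"
  shows "Phi x = Phi a + integral {a..x} std_normal_density"
proof -
  have "Phi x - Phi a = measure std_normal_distribution {a<..x}"
    unfolding Phi_def using std_normal.cdf_diff_eq[of a x] assms
    by (cases "a = x") auto
  also have "\<dots> = measure std_normal_distribution {a..x}"
  proof -
    have "{a..x} = {a} \<union> {a<..x}" using assms by auto
    moreover have "measure std_normal_distribution ({a} \<union> {a<..x}) =
      measure std_normal_distribution {a} + measure std_normal_distribution {a<..x}"
      by (intro std_normal.finite_measure_Union) auto
    ultimately show ?thesis
      by (simp add: measure_def emeasure_std_normal_singleton)
  qed
  also have "\<dots> = enn2real (\<integral>\<^sup>+y. ennreal (std_normal_density y * indicator {a..x} y) \<partial>lborel)"
    unfolding measure_def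
    by (subst emeasure_density) (auto intro!: arg_cong[where f=enn2real] nn_integral_cong simp: indicator_def)
  also have "\<dots> = (LINT y|lborel. std_normal_density y * indicator {a..x} y)"
    by (subst integral_eq_nn_integral) auto
  also have "\<dots> = (LINT y:{a..x}|lborel. std_normal_density y)"
    unfolding set_lebesgue_integral_def by (simp add: mult.commute)
  also have "\<dots> = integral {a..x} std_normal_density"
    by (rule set_borel_integral_eq_integral)
       (auto simp: set_integrable_def intro!: integrable_mult_indicator[where 'b = real, simplified])
  finally show ?thesis by simp
qed

lemma Phi_has_real_derivative: "(Phi has_real_derivative std_normal_density x) (at x)"
proof -
  have "((\<lambda>u. integral {x - 1..u} std_normal_density) has_real_derivative std_normal_density x)
      (at x within {x - 1..x + 1})"
    by (rule integral_has_real_derivative)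
       (auto simp: std_normal_density_def intro!: continuous_intros)
  then have "((\<lambda>u. Phi (x - 1) + integral {x - 1..u} std_normal_density) has_real_derivative std_normal_density x)
      (at x within {x - 1..x + 1})"
    by (auto intro!: derivative_eq_intros)
  then have "((\<lambda>u. Phi (x - 1) + integral {x - 1..u} std_normal_density) has_real_derivative std_normal_density x)
      (at x)"
    by (metis at_within_Icc_at less_add_one diff_less_eq)
  moreover have "eventually (\<lambda>u. Phi (x - 1) + integral {x - 1..u} std_normal_density = Phi u) (nhds x)"
    using eventually_nhds_in_open[of "{x - 1<..<x + 1}" x]
    by (rule eventually_mono) (auto intro!: Phi_add_integral[symmetric])
  ultimately show ?thesis
    by (subst (asm) DERIV_cong_ev) auto
qed

lemma std_normal_density_has_real_derivative:
  "(std_normal_density has_real_derivative - x * std_normal_density x) (at x)"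
  unfolding std_normal_density_def
  by (auto intro!: derivative_eq_intros simp: field_simps)

section \<open>Positivity, tail decay and the inverse Mills ratio\<close>

lemma Phi_pos: "0 < Phi x"
proof -
  have "Phi (x - 1) < Phi x"
    using DERIV_pos_imp_increasing[of "x - 1" x Phi] Phi_has_real_derivative normal_density_pos[of 1 0]
    by (metis less_add_one diff_less_eq zero_less_one)
  with Phi_nonneg[of "x - 1"] show ?thesis by simp
qed

text \<open>Chernoff bound with slope 1. Any exponential decay would do: its purpose is that
  \<open>y * Phi y\<close> tends to 0 at minus infinity.\<close>

lemma Phi_tail: "Phi x \<le> exp (x + 1 / 2)"
proof -
  have "ennreal (Phi x) = (\<integral>\<^sup>+y. indicator {..x} y \<partial>std_normal_distribution)"
    by (simp add: emeasure_std_normal_atMost)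
  also have "\<dots> \<le> (\<integral>\<^sup>+y. ennreal (exp x) * ennreal (exp (- 1 * y)) \<partial>std_normal_distribution)"
    by (intro nn_integral_mono) (auto simp: indicator_def ennreal_mult'[symmetric] exp_add[symmetric])
  also have "\<dots> = ennreal (exp x) * ennreal (exp (1 / 2))"
    by (subst nn_integral_cmult) (use nn_integral_std_normal_exp[of "-1"] in auto)
  also have "\<dots> = ennreal (exp (x + 1 / 2))"
    by (simp add: ennreal_mult'[symmetric] exp_add)
  finally show ?thesis by simp
qed

text \<open>Mills' ratio: the left-hand side has derivative \<open>Phi\<close> and vanishes at minus infinity.\<close>

lemma mult_Phi_add_density_nonneg: "0 \<le> x * Phi x + std_normal_density x"
proof (rule ccontr)
  let ?u = "\<lambda>x. x * Phi x + std_normal_density x"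
  assume neg: "\<not> 0 \<le> ?u x"
  have mono: "?u y \<le> ?u x" if "y \<le> x" for y
  proof (rule DERIV_nonneg_imp_nondecreasing[OF that])
    fix z assume "y \<le> z" "z \<le> x"
    have "(?u has_real_derivative Phi z) (at z)"
      by (auto intro!: derivative_eq_intros Phi_has_real_derivative std_normal_density_has_real_derivative)
    then show "\<exists>d. (?u has_real_derivative d) (at z) \<and> 0 \<le> d"
      using Phi_nonneg by blast
  qed
  \<comment> \<open>By monotonicity a negative value at \<open>x\<close> bounds the function away
    from 0 on everything to the left of \<open>x\<close>; the lower bound
    \<open>y * exp (y + 1 / 2)\<close>, which tends to 0, contradicts this.\<close>
  have "((\<lambda>y::real. y * exp (y + 1 / 2)) \<longlongrightarrow> 0) at_bot"
    by real_asymp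
  then have "eventually (\<lambda>y. ?u x < y * exp (y + 1 / 2)) at_bot"
    using neg by (intro order_tendstoD) auto
  moreover have "eventually (\<lambda>y. y \<le> min x 0) at_bot"
    by (rule eventually_le_at_bot)
  ultimately have "eventually (\<lambda>y::real. False) at_bot"
  proof eventually_elim
    case (elim y)
    have "y * exp (y + 1 / 2) \<le> y * Phi y"
      using elim Phi_tail[of y] by (intro mult_left_mono_neg) auto
    also have "\<dots> \<le> ?u y" by simp
    also have "\<dots> \<le> ?u x" using elim by (intro mono) auto
    finally show ?case using elim by simp
  qed
  then show False by simp
qed

text \<open>The logarithmic derivative of \<open>Phi\<close>; by symmetry, the hazard rate of the
  standard normal law at \<open>- x\<close>.\<close>

definition mills :: "real \<Rightarrow> real" where
  "mills x = std_normal_density x / Phi x"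

lemma mills_has_real_derivative:
  "(mills has_real_derivative - mills x * (x + mills x)) (at x)"
  unfolding mills_def using Phi_pos[of x]
  by (auto intro!: derivative_eq_intros Phi_has_real_derivative std_normal_density_has_real_derivative
      simp: field_simps)

lemma mills_pos: "0 < mills x"
  using Phi_pos[of x] by (simp add: mills_def normal_density_pos)

lemma add_mills_nonneg: "0 \<le> x + mills x"
  using mult_Phi_add_density_nonneg[of x] Phi_pos[of x] by (simp add: mills_def field_simps)

text \<open>This is the log-concavity of \<open>Phi\<close>: the derivative
  \<open>- mills x * (x + mills x)\<close> has its sign fixed by \<open>mills_pos\<close> and
  \<open>add_mills_nonneg\<close>.\<close>

lemma mills_antimono: "x \<le> y \<Longrightarrow> mills y \<le> mills x"
  by (rule DERIV_nonpos_imp_nonincreasing[where f = mills])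
     (use mills_has_real_derivative mills_pos add_mills_nonneg in
       \<open>auto simp: mult_nonneg_nonneg less_imp_le intro!: exI\<close>)

lemma ln_Phi_has_real_derivative: "((\<lambda>x. ln (Phi x)) has_real_derivative mills x) (at x)"
  using Phi_pos[of x]
  by (auto intro!: derivative_eq_intros Phi_has_real_derivative simp: mills_def)

lemma Phi_le_exp_tangent: "Phi x \<le> Phi a * exp (mills a * (x - a))"
proof -
  have "ln (Phi x) \<le> ln (Phi a) + mills a * (x - a)"
  proof (cases x a rule: linorder_cases)
    case less
    obtain z where "x < z" "z < a" "ln (Phi a) - ln (Phi x) = (a - x) * mills z"
      using MVT2[OF less, of "\<lambda>x. ln (Phi x)" mills] ln_Phi_has_real_derivative by blast
    moreover have "(a - x) * mills a \<le> (a - x) * mills z"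
      using less \<open>z < a\<close> by (intro mult_left_mono mills_antimono) auto
    ultimately show ?thesis by (simp add: algebra_simps)
  next
    case greater
    obtain z where "a < z" "z < x" "ln (Phi x) - ln (Phi a) = (x - a) * mills z"
      using MVT2[OF greater, of "\<lambda>x. ln (Phi x)" mills] ln_Phi_has_real_derivative by blast
    moreover have "(x - a) * mills z \<le> (x - a) * mills a"
      using greater \<open>a < z\<close> by (intro mult_left_mono mills_antimono) auto
    ultimately show ?thesis by (simp add: algebra_simps)
  qed simp
  then have "exp (ln (Phi x)) \<le> exp (ln (Phi a) + mills a * (x - a))" by simp
  then show ?thesis using Phi_pos by (simp add: exp_add)
qed

text \<open>\<open>x + mills x\<close> is the derivative of x^2 / 2 + ln (2 Phi x), the cumulant
  generating function of |N|, so this is its convexity on the half-line. The second derivative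
  \<open>1 - mills z * (z + mills z)\<close> is the variance of a normal variable conditioned to be
  at least \<open>- z\<close>.\<close>

lemma add_mills_mono:
  assumes "0 \<le> x" "x \<le> y"
  shows "x + mills x \<le> y + mills y"
proof -
  \<comment> \<open>The second derivative multiplied by (Phi x)^2. It starts at 1/4 - 1/(2 pi) and
    its derivative is visibly nonnegative for nonnegative arguments.\<close>
  let ?h = "\<lambda>x. (Phi x)\<^sup>2 - x * std_normal_density x * Phi x - (std_normal_density x)\<^sup>2"
  have h: "0 \<le> ?h z" if "0 \<le> z" for z
  proof -
    have "0 \<le> ?h 0"
      using pi_gt3 by (simp add: Phi_0 std_normal_density_def power2_eq_square field_simps)
    also have "?h 0 \<le> ?h z"
    proof (rule DERIV_nonneg_imp_nondecreasing[OF that])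
      fix t :: real assume t: "0 \<le> t" "t \<le> z"
      let ?d = "std_normal_density t * Phi t * (1 + t\<^sup>2) + t * (std_normal_density t)\<^sup>2"
      have "(?h has_real_derivative ?d) (at t)"
        by (rule derivative_eq_intros Phi_has_real_derivative std_normal_density_has_real_derivative refl)+
           (simp add: algebra_simps power2_eq_square)
      moreover have "0 \<le> ?d" using t Phi_nonneg by simp
      ultimately show "\<exists>d. (?h has_real_derivative d) (at t) \<and> 0 \<le> d" by blast
    qed
    finally show ?thesis .
  qed
  show ?thesis
  proof (rule DERIV_nonneg_imp_nondecreasing[where f = "\<lambda>x. x + mills x", OF assms(2)])
    fix z assume "x \<le> z" "z \<le> y"
    have "((\<lambda>x. x + mills x) has_real_derivative 1 - mills z * (z + mills z)) (at z)"
      by (auto intro!: derivative_eq_intros mills_has_real_derivative)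
    moreover have "0 \<le> 1 - mills z * (z + mills z)"
      using h[of z] Phi_pos[of z] \<open>x \<le> z\<close> assms
      by (simp add: mills_def field_simps power2_eq_square)
    ultimately show "\<exists>d. ((\<lambda>x. x + mills x) has_real_derivative d) (at z) \<and> 0 \<le> d" by blast
  qed
qed

lemma mills_0: "mills 0 = sqrt (2 / pi)"
  by (simp add: mills_def Phi_0 std_normal_density_def real_sqrt_divide real_sqrt_mult field_simps)

text \<open>Existence is the intermediate value theorem on [0, 1], using sqrt (2 / pi) \<le> 1. The
  third property places \<open>2 * l\<close> in the half-line over which \<open>R\<close> is
  maximised: compare \<open>x + mills x\<close> at 0 and at \<open>l\<close>.\<close>

lemma mills_fixed_point:
  obtains l where "mills l = l" "0 < l" "mills 0 \<le> 2 * l"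
proof -
  have "mills 1 \<le> mills 0" by (rule mills_antimono) simp
  also have "mills 0 \<le> 1" using pi_gt3 by (simp add: mills_0)
  finally have "mills 1 - 1 \<le> 0" by simp
  moreover have "0 \<le> mills 0 - 0" using mills_pos[of 0] by simp
  moreover have "continuous_on {0..1} (\<lambda>x. mills x - x)"
    using mills_has_real_derivative
    by (auto intro!: continuous_intros continuous_at_imp_continuous_on intro: DERIV_isCont)
  ultimately obtain l where l: "0 \<le> l" "l \<le> 1" "mills l - l = 0"
    using IVT2'[of "\<lambda>x. mills x - x" 1 0 0] by auto
  show thesis
  proof (rule that[of l])
    show "mills l = l" "0 < l" using l mills_pos[of l] by auto
    show "mills 0 \<le> 2 * l" using add_mills_mono[of 0 l] l by simp
  qed
qed

section \<open>The variational problem behind \<open>v_star\<close> and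
  \<open>alpha_star\<close>\<close>

lemma phi_nonneg: "0 \<le> l \<Longrightarrow> 0 \<le> phi l"
  using Phi_mono[of 0 l] by (simp add: phi_def Phi_0)

text \<open>A real \<open>SUP\<close> dominates its members only if the family is bounded above;
  completing the square gives the bound x^2 / 2.\<close>

lemma mu_star_upper:
  assumes "0 \<le> l"
  shows "l * x - l\<^sup>2 / 2 - phi l \<le> mu_star x"
  unfolding mu_star_def
proof (rule cSUP_upper)
  show "bdd_above ((\<lambda>l. l * x - l\<^sup>2 / 2 - phi l) ` {0..})"
  proof (rule bdd_aboveI2)
    fix l :: real assume "l \<in> {0..}"
    moreover have "0 \<le> (l - x)\<^sup>2" by simp
    ultimately show "l * x - l\<^sup>2 / 2 - phi l \<le> x\<^sup>2 / 2"
      using phi_nonneg[of l] by (simp add: power2_eq_square algebra_simps)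
  qed
qed (use assms in auto)

text \<open>At \<open>x = 2 * l\<close> the supremum is attained at \<open>l\<close>, as its objective has derivative
  \<open>2 * l - (t + mills t)\<close> at \<open>t\<close>, which changes sign at \<open>l\<close> only.\<close>

lemma mu_star_at_fixed_point:
  assumes "mills l = l" "0 < l"
  shows "mu_star (2 * l) = 3 * l\<^sup>2 / 2 - phi l"
proof (rule antisym)
  let ?k = "\<lambda>t. t * (2 * l) - t\<^sup>2 / 2 - phi t"
  have deriv: "(?k has_real_derivative 2 * l - (t + mills t)) (at t)" for t
    unfolding phi_def using Phi_pos[of t]
    by (auto intro!: derivative_eq_intros Phi_has_real_derivative simp: mills_def)
  show "mu_star (2 * l) \<le> 3 * l\<^sup>2 / 2 - phi l"
    unfolding mu_star_def
  proof (rule cSUP_least)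
    fix t :: real assume "t \<in> {0..}"
    then have "0 \<le> t" by simp
    have "?k t \<le> ?k l"
    proof (cases "t \<le> l")
      case True
      show ?thesis
      proof (rule DERIV_nonneg_imp_nondecreasing[OF True])
        fix z assume "t \<le> z" "z \<le> l"
        then show "\<exists>d. (?k has_real_derivative d) (at z) \<and> 0 \<le> d"
          using deriv[of z] add_mills_mono[of z l] \<open>0 \<le> t\<close> assms by (intro exI conjI) (assumption, auto)
      qed
    next
      case False
      then have "l \<le> t" by simp
      show ?thesis
      proof (rule DERIV_nonpos_imp_nonincreasing[OF \<open>l \<le> t\<close>])
        fix z assume "l \<le> z" "z \<le> t"
        then show "\<exists>d. (?k has_real_derivative d) (at z) \<and> d \<le> 0"
          using deriv[of z] add_mills_mono[of l z] assms by (intro exI conjI) (assumption, auto)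
      qed
    qed
    then show "?k t \<le> 3 * l\<^sup>2 / 2 - phi l"
      by (simp add: power2_eq_square)
  qed simp
  show "3 * l\<^sup>2 / 2 - phi l \<le> mu_star (2 * l)"
    using mu_star_upper[of l "2 * l"] assms by (simp add: power2_eq_square)
qed

text \<open>The quadratic gap \<open>R x \<le> R (2 * l) - (x / 2 - l)^2 / 2\<close> gives
  maximality and uniqueness together, which is what evaluating the \<open>THE\<close> in
  \<open>v_star\<close> requires.\<close>

lemma v_star_alpha_star_at_fixed_point:
  assumes "mills l = l" "0 < l" "mills 0 \<le> 2 * l"
  shows "v_star = 2 * l" "alpha_star = ln 2 + ln (Phi l) - l\<^sup>2 / 2"
proof -
  have Rl: "R (2 * l) = ln 2 + ln (Phi l) - l\<^sup>2 / 2"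
    using Phi_pos[of l]
    by (simp add: R_def mu_star_at_fixed_point[OF assms(1,2)] phi_def ln_mult power2_eq_square)
  have less: "R x < R (2 * l)" if x: "sqrt (2 / pi) \<le> x" "x \<noteq> 2 * l" for x
  proof -
    have "0 \<le> x" using x(1) by (rule order_trans[rotated]) simp
    \<comment> \<open>Trial value \<open>x / 2\<close> in the supremum; it is the exact maximiser
      when \<open>x = 2 * l\<close>.\<close>
    have "R x \<le> ln 2 + ln (Phi (x / 2)) - x\<^sup>2 / 8"
      using mu_star_upper[of "x / 2" x] \<open>0 \<le> x\<close> Phi_pos[of "x / 2"]
      by (simp add: R_def phi_def ln_mult power2_eq_square)
    also have "ln (Phi (x / 2)) \<le> ln (Phi l * exp (l * (x / 2 - l)))"
      using Phi_le_exp_tangent[of "x / 2" l] Phi_pos[of "x / 2"] Phi_pos[of l] assms(1) by simp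
    also have "\<dots> = ln (Phi l) + l * (x / 2 - l)"
      using Phi_pos[of l] by (simp add: ln_mult)
    finally have "R x \<le> R (2 * l) - (x / 2 - l)\<^sup>2 / 2"
      unfolding Rl by (simp add: power2_eq_square field_simps)
    moreover have "0 < (x / 2 - l)\<^sup>2" using x(2) by simp
    ultimately show ?thesis by linarith
  qed
  show v: "v_star = 2 * l"
    unfolding v_star_def
  proof (rule the_equality)
    show "is_arg_max R (\<lambda>x. sqrt (2 / pi) \<le> x) (2 * l)"
      using assms(3) less unfolding is_arg_max_def mills_0
      by (metis less_asym less_irrefl)
    show "v = 2 * l" if "is_arg_max R (\<lambda>x. sqrt (2 / pi) \<le> x) v" for v
      using that less assms(3) unfolding is_arg_max_def mills_0 by metis
  qed
  show "alpha_star = ln 2 + ln (Phi l) - l\<^sup>2 / 2"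
    by (simp add: alpha_star_def v Rl)
qed

section \<open>Characteristic functions determine finite-dimensional laws\<close>

lemma borel_measurable_component_of_sets:
  assumes "sets P = sets (PiM I (\<lambda>_. borel :: real measure))" "i \<in> I"
  shows "(\<lambda>v. v i) \<in> borel_measurable P"
proof -
  have "(\<lambda>v. v i) \<in> borel_measurable (PiM I (\<lambda>_. borel :: real measure))"
    using assms(2) by measurable
  then show ?thesis using assms(1) by (simp cong: measurable_cong_sets)
qed

text \<open>The Gaussian bump is the average of \<open>iexp (t * k * (x - v))\<close> over a standard normal \<open>t\<close>,
  which brings in the characteristic function without any integrability requirement.\<close>

lemma integral_prod_Gaussian_bumps:
  fixes P :: "('i \<Rightarrow> real) measure"
  assumes "prob_space P" and P: "sets P = sets (PiM I (\<lambda>_. borel))" and I: "finite I"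
  shows "complex_of_real (LINT v|P. (\<Prod>i\<in>I. exp (- (k * (x i - v i))\<^sup>2 / 2))) =
    (CLINT t|PiM I (\<lambda>_. std_normal_distribution).
      iexp (\<Sum>i\<in>I. k * t i * x i) * (CLINT v|P. iexp (\<Sum>i\<in>I. (- k * t i) * v i)))"
proof -
  let ?T = "PiM I (\<lambda>_. std_normal_distribution)"
  interpret P: prob_space P by fact
  interpret T: prob_space ?T
    by (rule prob_space_PiM) (rule std_normal.prob_space_axioms)
  interpret T': product_sigma_finite "\<lambda>_. std_normal_distribution"
    by standard
  interpret PT: pair_prob_space P ?T ..
  note borel_measurable_component_of_sets[OF P, measurable (raw)]
  have [measurable (raw)]: "(\<lambda>t. t i) \<in> borel_measurable ?T" if "i \<in> I" for i
    using measurable_component_singleton[OF that, of "\<lambda>_. std_normal_distribution"]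
    by (simp cong: measurable_cong_sets)
  \<comment> \<open>Integrating \<open>f\<close> over \<open>t\<close> first gives the bump, over
    \<open>v\<close> first the characteristic function. Fubini applies because \<open>f\<close> is
    bounded by 1 on a product of probability spaces.\<close>
  define f where "f v t = iexp (\<Sum>i\<in>I. (k * (x i - v i)) * t i)" for v t :: "'i \<Rightarrow> real"
  have f_eq: "iexp (\<Sum>i\<in>I. k * t i * x i) * iexp (\<Sum>i\<in>I. (- k * t i) * v i) = f v t" for t v
  proof -
    have "(\<Sum>i\<in>I. k * t i * x i) + (\<Sum>i\<in>I. (- k * t i) * v i) = (\<Sum>i\<in>I. (k * (x i - v i)) * t i)"
      by (simp add: sum.distrib[symmetric] algebra_simps)
    then show ?thesis
      by (metis f_def exp_add distrib_left of_real_add)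
  qed
  have norm_f: "norm (f v t) \<le> 1" for v t
    by (simp add: f_def)
  have [measurable]: "(\<lambda>p. fst p i) \<in> borel_measurable (P \<Otimes>\<^sub>M ?T)"
    "(\<lambda>p. snd p i) \<in> borel_measurable (P \<Otimes>\<^sub>M ?T)" if "i \<in> I" for i
    using that by (auto intro: measurable_compose[OF measurable_fst] measurable_compose[OF measurable_snd])
  have [measurable]: "case_prod f \<in> borel_measurable (P \<Otimes>\<^sub>M ?T)"
    unfolding f_def case_prod_beta by measurable
  have inner: "(CLINT t|?T. f v t) = complex_of_real (\<Prod>i\<in>I. exp (- (k * (x i - v i))\<^sup>2 / 2))" for v
  proof -
    have "(CLINT t|?T. f v t) = (CLINT t|?T. (\<Prod>i\<in>I. iexp ((k * (x i - v i)) * t i)))"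
      unfolding f_def by (simp add: exp_sum[OF I] sum_distrib_left)
    also have "\<dots> = (\<Prod>i\<in>I. CLINT y|std_normal_distribution. iexp ((k * (x i - v i)) * y))"
      by (rule T'.product_integral_prod[OF I])
         (auto intro!: std_normal.integrable_const_bound[where B = 1])
    also have "\<dots> = (\<Prod>i\<in>I. char std_normal_distribution (k * (x i - v i)))"
      by (simp add: char_def)
    finally show ?thesis
      by (simp add: char_std_normal_distribution)
  qed
  have "complex_of_real (LINT v|P. (\<Prod>i\<in>I. exp (- (k * (x i - v i))\<^sup>2 / 2))) = (CLINT v|P. CLINT t|?T. f v t)"
    by (simp only: inner integral_complex_of_real)
  also have "\<dots> = (CLINT t|?T. CLINT v|P. f v t)"
    by (rule PT.Fubini_integral[symmetric], rule PT.integrable_const_bound[where B = 1])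
       (auto simp: norm_f)
  also have "\<dots> = (CLINT t|?T. iexp (\<Sum>i\<in>I. k * t i * x i) * (CLINT v|P. iexp (\<Sum>i\<in>I. (- k * t i) * v i)))"
    by (simp only: f_eq[symmetric] integral_mult_right_zero)
  finally show ?thesis .
qed

lemma nn_integral_shifted_normal:
  assumes "0 < k"
  shows "(\<integral>\<^sup>+x. indicator {c..} x * ennreal (k * std_normal_density (k * (x - v))) \<partial>lborel) =
    ennreal (Phi (k * (v - c)))"
proof -
  have "(\<integral>\<^sup>+x. indicator {c..} x * ennreal (k * std_normal_density (k * (x - v))) \<partial>lborel) =
      ennreal (1 / k) * (\<integral>\<^sup>+y. indicator {c..} (v + (1 / k) * y) *
        ennreal (k * std_normal_density (k * (v + (1 / k) * y - v))) \<partial>lborel)"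
    using assms
    by (subst nn_integral_real_affine[where c = "1 / k" and t = v]) auto
  also have "\<dots> = (\<integral>\<^sup>+y. ennreal (std_normal_density y) * indicator {- (k * (v - c))..} y \<partial>lborel)"
    using assms
    by (subst nn_integral_cmult[symmetric])
       (auto intro!: nn_integral_cong simp: indicator_def ennreal_mult'[symmetric] field_simps)
  also have "\<dots> = ennreal (Phi (k * (v - c)))"
    using emeasure_std_normal_atLeast[of "- (k * (v - c))"]
    by (subst (asm) emeasure_density) auto
  finally show ?thesis .
qed

text \<open>A product of \<open>Phi\<close> factors is a smoothed orthant indicator, namely an
  integral of Gaussian bumps centred in the orthant. After exchanging the integrals,
  \<open>P\<close> enters only through its bump integrals, which its characteristic function
  determines.\<close>

lemma nn_integral_prod_Phi:
  fixes P :: "('i \<Rightarrow> real) measure"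
  assumes "prob_space P" and P: "sets P = sets (PiM I (\<lambda>_. borel))" and I: "finite I" and k: "0 < k"
  shows "(\<integral>\<^sup>+v. (\<Prod>i\<in>I. ennreal (Phi (k * (v i - c i)))) \<partial>P) =
    (\<integral>\<^sup>+x. (\<Prod>i\<in>I. indicator {c i..} (x i) * ennreal (k / sqrt (2 * pi))) *
      ennreal (LINT v|P. (\<Prod>i\<in>I. exp (- (k * (x i - v i))\<^sup>2 / 2))) \<partial>PiM I (\<lambda>_. lborel))"
proof -
  let ?L = "PiM I (\<lambda>_. lborel :: real measure)"
  interpret P: prob_space P by fact
  interpret L: product_sigma_finite "\<lambda>_. lborel :: real measure" by standard
  interpret L': finite_product_sigma_finite "\<lambda>_. lborel :: real measure" I by standard (rule I)
  interpret PL: pair_sigma_finite P ?L ..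
  note borel_measurable_component_of_sets[OF P, measurable (raw)]
  have [measurable (raw)]: "(\<lambda>x. x i) \<in> borel_measurable ?L" if "i \<in> I" for i
    using measurable_component_singleton[OF that, of "\<lambda>_. lborel"]
    by (simp cong: measurable_cong_sets)
  let ?g = "\<lambda>i x v. indicator {c i..} x * ennreal (k * std_normal_density (k * (x - v)))"
  have "(\<integral>\<^sup>+v. (\<Prod>i\<in>I. ennreal (Phi (k * (v i - c i)))) \<partial>P) =
      (\<integral>\<^sup>+v. (\<integral>\<^sup>+x. (\<Prod>i\<in>I. ?g i (x i) (v i)) \<partial>?L) \<partial>P)"
    by (subst L.product_nn_integral_prod[OF I]) (auto simp: nn_integral_shifted_normal[OF k])
  also have "\<dots> = (\<integral>\<^sup>+x. (\<integral>\<^sup>+v. (\<Prod>i\<in>I. ?g i (x i) (v i)) \<partial>P) \<partial>?L)"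
  proof (rule PL.Fubini'[symmetric])
    have [measurable]: "(\<lambda>p. fst p i) \<in> borel_measurable (P \<Otimes>\<^sub>M ?L)"
      "(\<lambda>p. snd p i) \<in> borel_measurable (P \<Otimes>\<^sub>M ?L)" if "i \<in> I" for i
      using that by (auto intro: measurable_compose[OF measurable_fst] measurable_compose[OF measurable_snd])
    have [measurable]: "(\<lambda>p. ?g i (fst p) (snd p)) \<in> borel_measurable (borel \<Otimes>\<^sub>M borel)" for i
      by measurable
    have "(\<lambda>p. ?g i (snd p i) (fst p i)) \<in> borel_measurable (P \<Otimes>\<^sub>M ?L)" if "i \<in> I" for i
      using that measurable_compose[of "\<lambda>p. (snd p i, fst p i)" "P \<Otimes>\<^sub>M ?L" "borel \<Otimes>\<^sub>M borel"
        "\<lambda>p. ?g i (fst p) (snd p)" borel] by simp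
    then show "(\<lambda>(v, x). \<Prod>i\<in>I. ?g i (x i) (v i)) \<in> borel_measurable (P \<Otimes>\<^sub>M ?L)"
      unfolding case_prod_beta by (rule borel_measurable_prod_ennreal)
  qed
  also have "\<dots> = (\<integral>\<^sup>+x. (\<integral>\<^sup>+v. (\<Prod>i\<in>I. indicator {c i..} (x i) * ennreal (k / sqrt (2 * pi))) *
      ennreal (\<Prod>i\<in>I. exp (- (k * (x i - v i))\<^sup>2 / 2)) \<partial>P) \<partial>?L)"
    using k
    by (intro nn_integral_cong)
       (auto simp: prod.distrib[symmetric] std_normal_density_def prod_ennreal[symmetric]
          ennreal_mult'[symmetric] mult.assoc intro!: prod.cong)
  also have "\<dots> = (\<integral>\<^sup>+x. (\<Prod>i\<in>I. indicator {c i..} (x i) * ennreal (k / sqrt (2 * pi))) *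
      ennreal (LINT v|P. (\<Prod>i\<in>I. exp (- (k * (x i - v i))\<^sup>2 / 2))) \<partial>?L)"
  proof (intro nn_integral_cong)
    fix x
    have "integrable P (\<lambda>v. \<Prod>i\<in>I. exp (- (k * (x i - v i))\<^sup>2 / 2))"
      by (rule P.integrable_const_bound[where B = 1]) (auto simp: abs_prod intro!: prod_le_1)
    then show "(\<integral>\<^sup>+v. (\<Prod>i\<in>I. indicator {c i..} (x i) * ennreal (k / sqrt (2 * pi))) *
        ennreal (\<Prod>i\<in>I. exp (- (k * (x i - v i))\<^sup>2 / 2)) \<partial>P) =
      (\<Prod>i\<in>I. indicator {c i..} (x i) * ennreal (k / sqrt (2 * pi))) *
        ennreal (LINT v|P. (\<Prod>i\<in>I. exp (- (k * (x i - v i))\<^sup>2 / 2)))"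
      by (subst nn_integral_cmult) (auto simp: nn_integral_eq_integral prod_nonneg)
  qed
  finally show ?thesis .
qed

text \<open>The drift \<open>- n\<close> makes the limit \<open>0\<close> also on the boundary \<open>d = 0\<close>.\<close>

lemma Phi_LIMSEQ_step:
  "(\<lambda>n. Phi ((real n)\<^sup>2 * d - real n)) \<longlonglongrightarrow> (if 0 < d then 1 else 0)"
proof (cases "0 < d")
  case True
  then have "filterlim (\<lambda>n. (real n)\<^sup>2 * d - real n) at_top sequentially"
    by real_asymp
  then show ?thesis
    using True filterlim_compose[OF std_normal.cdf_lim_at_top_prob] unfolding Phi_def by auto
next
  case False
  have "filterlim (\<lambda>n. - real n) at_bot sequentially"
    by real_asymp
  then have "filterlim (\<lambda>n. (real n)\<^sup>2 * d - real n) at_bot sequentially"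
    by (rule filterlim_at_bot_mono) (use False in \<open>auto simp: mult_nonneg_nonpos\<close>)
  then show ?thesis
    using False filterlim_compose[OF std_normal.cdf_lim_at_bot] unfolding Phi_def by auto
qed

text \<open>Dominated convergence with bound 1. The smoothing width 1 / n^2 shrinks faster than the
  threshold \<open>c i + 1 / n\<close> approaches \<open>c i\<close>, so the limit is the open
  orthant even if \<open>P\<close> charges its boundary.\<close>

lemma measure_orthant_LIMSEQ:
  fixes P :: "('i \<Rightarrow> real) measure"
  assumes "prob_space P" and P: "sets P = sets (PiM I (\<lambda>_. borel))" and I: "finite I"
  shows "(\<lambda>n. LINT v|P. (\<Prod>i\<in>I. Phi ((real n)\<^sup>2 * (v i - c i) - real n)))
    \<longlonglongrightarrow> measure P (Pi\<^sub>E I (\<lambda>i. {c i<..}))"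
proof -
  interpret P: prob_space P by fact
  note borel_measurable_component_of_sets[OF P, measurable (raw)]
  have [measurable]: "Phi \<in> borel_measurable borel"
    by (rule borel_measurable_mono) (simp add: mono_def Phi_mono)
  have sp: "space P = Pi\<^sub>E I (\<lambda>_. UNIV)"
    using sets_eq_imp_space_eq[OF P] by (simp add: space_PiM)
  have box: "Pi\<^sub>E I (\<lambda>i. {c i<..}) \<in> sets P"
    unfolding P using I by (auto intro!: sets_PiM_I_finite)
  have lim: "(\<lambda>n. \<Prod>i\<in>I. Phi ((real n)\<^sup>2 * (v i - c i) - real n))
      \<longlonglongrightarrow> (\<Prod>i\<in>I. if 0 < v i - c i then 1 else 0)" for v
    by (intro tendsto_prod Phi_LIMSEQ_step)
  have "(\<lambda>n. LINT v|P. (\<Prod>i\<in>I. Phi ((real n)\<^sup>2 * (v i - c i) - real n)))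
      \<longlonglongrightarrow> (LINT v|P. (\<Prod>i\<in>I. if 0 < v i - c i then 1 else 0))"
    by (rule integral_dominated_convergence[where w = "\<lambda>_. 1"])
       (auto intro!: lim[simplified] prod_le_1 simp: abs_prod Phi_nonneg Phi_le_1)
  also have "(LINT v|P. (\<Prod>i\<in>I. if 0 < v i - c i then 1 else 0 :: real)) =
      (LINT v|P. indicator (Pi\<^sub>E I (\<lambda>i. {c i<..})) v)"
  \<comment> \<open>Points of \<open>space P\<close> are extensional, so membership in
    \<open>Pi\<^sub>E\<close> reduces to the coordinate inequalities.\<close>
  proof (rule Bochner_Integration.integral_cong[OF refl])
    fix v assume "v \<in> space P"
    then have "v \<in> extensional I" by (simp add: sp PiE_iff)
    then show "(\<Prod>i\<in>I. if 0 < v i - c i then 1 else 0 :: real) = indicator (Pi\<^sub>E I (\<lambda>i. {c i<..})) v"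
      by (cases "\<forall>i\<in>I. c i < v i") (auto simp: indicator_def PiE_iff I)
  qed
  also have "\<dots> = measure P (Pi\<^sub>E I (\<lambda>i. {c i<..}))"
    using box by simp
  finally show ?thesis .
qed

lemma sets_PiM_borel_eq_orthants:
  assumes I: "finite I"
  shows "sets (PiM I (\<lambda>_. borel :: real measure)) =
    sigma_sets (Pi\<^sub>E I (\<lambda>_. UNIV)) (range (\<lambda>c. Pi\<^sub>E I (\<lambda>i. {c i<..})))"
    (is "_ = sigma_sets ?O ?E")
proof (rule antisym)
  have E: "?E \<subseteq> Pow ?O" by (auto simp: PiE_iff)
  have "(\<lambda>v. v) \<in> measurable (sigma ?O ?E) (PiM I (\<lambda>_. borel :: real measure))"
  proof (rule measurable_PiM_single')
    fix i assume i: "i \<in> I"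
    show "(\<lambda>v. v i) \<in> borel_measurable (sigma ?O ?E)"
    proof (rule borel_measurableI_greater)
      fix a
      have "{v \<in> space (sigma ?O ?E). a < v i} =
          (\<Union>n::nat. Pi\<^sub>E I (\<lambda>j. {(if j = i then a else - real n)<..}))" (is "?l = ?r")
      proof (intro equalityI subsetI)
        fix v assume v: "v \<in> ?l"
        obtain n :: nat where n: "(\<Sum>j\<in>I. \<bar>v j\<bar>) < real n"
          using reals_Archimedean2 by blast
        have "- real n < v j" if "j \<in> I" for j
          using member_le_sum[OF that, of "\<lambda>j. \<bar>v j\<bar>"] I n by (simp add: abs_le_iff)
        then show "v \<in> ?r" using v by (auto simp: PiE_iff space_measure_of[OF E] intro!: exI[of _ n])
      qed (use i in \<open>auto simp: PiE_iff space_measure_of[OF E] split: if_splits\<close>)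
      also have "\<dots> \<in> sets (sigma ?O ?E)"
        by (intro sets.countable_UN) (auto simp: E)
      finally show "{v \<in> space (sigma ?O ?E). a < v i} \<in> sets (sigma ?O ?E)" .
    qed
  qed (auto simp: E)
  note id = this
  have "A \<in> sigma_sets ?O ?E" if "A \<in> sets (PiM I (\<lambda>_. borel :: real measure))" for A
  proof -
    have "A \<subseteq> ?O"
      using sets.sets_into_space[OF that] by (simp add: space_PiM)
    then show ?thesis
      using measurable_sets[OF id that]
      by (simp add: space_measure_of[OF E] sets_measure_of[OF E] Int_absorb2)
  qed
  then show "sets (PiM I (\<lambda>_. borel :: real measure)) \<subseteq> sigma_sets ?O ?E" by blast
  have "?E \<subseteq> sets (PiM I (\<lambda>_. borel :: real measure))"
    using I by (auto intro!: sets_PiM_I_finite)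
  then show "sigma_sets ?O ?E \<subseteq> sets (PiM I (\<lambda>_. borel :: real measure))"
    using sets.sigma_sets_subset[of ?E "PiM I (\<lambda>_. borel :: real measure)"] by (simp add: space_PiM)
qed

text \<open>The characteristic function fixes the bump integrals, these fix the smoothed orthant
  indicators, and in the limit the measures of open orthants, a generating system closed under
  intersection.\<close>

theorem measure_PiM_borel_eqI_char:
  fixes P Q :: "('i \<Rightarrow> real) measure"
  assumes PQ: "prob_space P" "prob_space Q"
    and sets: "sets P = sets (PiM I (\<lambda>_. borel))" "sets Q = sets (PiM I (\<lambda>_. borel))"
    and I: "finite I"
    and char: "\<And>t. (CLINT v|P. iexp (\<Sum>i\<in>I. t i * v i)) = (CLINT v|Q. iexp (\<Sum>i\<in>I. t i * v i))"
  shows "P = Q"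
proof (rule measure_eqI_generator_eq)
  interpret P: prob_space P by fact
  interpret Q: prob_space Q by fact
  let ?E = "range (\<lambda>c. Pi\<^sub>E I (\<lambda>i. {c i<..})) :: ('i \<Rightarrow> real) set set"
  show "Int_stable ?E"
  proof (rule Int_stableI)
    fix A B :: "('i \<Rightarrow> real) set" assume "A \<in> ?E" "B \<in> ?E"
    then obtain c d where "A = Pi\<^sub>E I (\<lambda>i. {c i<..})" "B = Pi\<^sub>E I (\<lambda>i. {d i<..})" by auto
    then have "A \<inter> B = Pi\<^sub>E I (\<lambda>i. {max (c i) (d i)<..})" by (auto simp: PiE_iff)
    then show "A \<inter> B \<in> ?E" by (metis rangeI)
  qed
  show "?E \<subseteq> Pow (Pi\<^sub>E I (\<lambda>_. UNIV))" by (auto simp: PiE_iff)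
  show "sets P = sigma_sets (Pi\<^sub>E I (\<lambda>_. UNIV)) ?E" "sets Q = sigma_sets (Pi\<^sub>E I (\<lambda>_. UNIV)) ?E"
    using sets sets_PiM_borel_eq_orthants[OF I] by simp_all
  show "range (\<lambda>n::nat. Pi\<^sub>E I (\<lambda>i. {- real n<..})) \<subseteq> ?E" by auto
  show "(\<Union>n::nat. Pi\<^sub>E I (\<lambda>i. {- real n<..})) = Pi\<^sub>E I (\<lambda>_. UNIV)"
  proof (intro equalityI subsetI)
    fix v :: "'i \<Rightarrow> real" assume v: "v \<in> Pi\<^sub>E I (\<lambda>_. UNIV)"
    obtain n :: nat where n: "(\<Sum>j\<in>I. \<bar>v j\<bar>) < real n"
      using reals_Archimedean2 by blast
    have "- real n < v j" if "j \<in> I" for j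
      using member_le_sum[OF that, of "\<lambda>j. \<bar>v j\<bar>"] I n by (simp add: abs_le_iff)
    then show "v \<in> (\<Union>n::nat. Pi\<^sub>E I (\<lambda>i. {- real n<..}))" using v by (auto simp: PiE_iff)
  qed (auto simp: PiE_iff)
  show "emeasure P (Pi\<^sub>E I (\<lambda>i. {- real n<..})) \<noteq> \<infinity>" for n :: nat
    by (simp add: P.emeasure_eq_measure)
  have bumps: "(LINT v|P. (\<Prod>i\<in>I. exp (- (k * (x i - v i))\<^sup>2 / 2))) =
      (LINT v|Q. (\<Prod>i\<in>I. exp (- (k * (x i - v i))\<^sup>2 / 2)))" (is "?p = ?q") for k x
  proof -
    have "complex_of_real ?p = complex_of_real ?q"
      unfolding integral_prod_Gaussian_bumps[OF PQ(1) sets(1) I] integral_prod_Gaussian_bumps[OF PQ(2) sets(2) I]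
        char ..
    then show ?thesis by (simp only: of_real_eq_iff)
  qed
  have LINT: "(LINT v|P. (\<Prod>i\<in>I. Phi (k * (v i - c i)))) = (LINT v|Q. (\<Prod>i\<in>I. Phi (k * (v i - c i))))"
    if "0 < k" for k c
  proof -
    have enn: "(LINT v|P'. (\<Prod>i\<in>I. Phi (k * (v i - c i)))) =
        enn2real (\<integral>\<^sup>+v. (\<Prod>i\<in>I. ennreal (Phi (k * (v i - c i)))) \<partial>P')"
      if P': "sets P' = sets (PiM I (\<lambda>_. borel))" for P'
    proof -
      note borel_measurable_component_of_sets[OF P', measurable (raw)]
      have [measurable]: "Phi \<in> borel_measurable borel"
        by (rule borel_measurable_mono) (simp add: mono_def Phi_mono)
      show ?thesis
        by (subst integral_eq_nn_integral) (auto simp: prod_ennreal Phi_nonneg prod_nonneg)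
    qed
    show ?thesis
      unfolding enn[OF sets(1)] enn[OF sets(2)]
      using nn_integral_prod_Phi[OF PQ(1) sets(1) I that] nn_integral_prod_Phi[OF PQ(2) sets(2) I that]
      by (simp only: bumps)
  qed
  fix A assume "A \<in> ?E"
  then obtain c where A: "A = Pi\<^sub>E I (\<lambda>i. {c i<..})" by auto
  have "eventually (\<lambda>n. (LINT v|P. (\<Prod>i\<in>I. Phi ((real n)\<^sup>2 * (v i - c i) - real n))) =
      (LINT v|Q. (\<Prod>i\<in>I. Phi ((real n)\<^sup>2 * (v i - c i) - real n)))) sequentially"
    using eventually_gt_at_top[of 0]
  proof eventually_elim
    case (elim n)
    \<comment> \<open>The drift is absorbed into the threshold, so the sequence is an instance of
      \<open>LINT\<close> with scale n^2 and thresholds \<open>c i + 1 / n\<close>.\<close>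
    have "(real n)\<^sup>2 * (v - (c i + 1 / real n)) = (real n)\<^sup>2 * (v - c i) - real n" for i v
      using elim by (simp add: field_simps power2_eq_square)
    then show ?case
      using LINT[of "(real n)\<^sup>2" "\<lambda>i. c i + 1 / real n"] elim by simp
  qed
  from Lim_transform_eventually[OF measure_orthant_LIMSEQ[OF PQ(1) sets(1) I] this]
    measure_orthant_LIMSEQ[OF PQ(2) sets(2) I]
  have "measure P A = measure Q A"
    unfolding A by (rule LIMSEQ_unique)
  then show "emeasure P A = emeasure Q A"
    by (simp add: P.emeasure_eq_measure Q.emeasure_eq_measure)
qed

section \<open>The joint law of the local fields\<close>

text \<open>For symmetric \<open>w\<close> with zero diagonal this is minus \<sigma> k times the sum
  of \<sigma> j * w k j. Summing over \<open>index_pairs\<close> keeps only the upper triangle,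
  where the entries are independent. The sign makes local optimality the nonnegativity of all
  fields.\<close>

definition local_field :: "nat \<Rightarrow> (nat \<Rightarrow> nat \<Rightarrow> real) \<Rightarrow> (nat \<Rightarrow> real) \<Rightarrow> nat \<Rightarrow> real" where
  "local_field n w \<sigma> k =
    - (\<Sum>(i, j)\<in>index_pairs n. if k = i \<or> k = j then \<sigma> i * \<sigma> j * w i j else 0)"

lemma finite_index_pairs [simp]: "finite (index_pairs n)"
  by (rule finite_subset[of _ "{1..n} \<times> {1..n}"]) (auto simp: index_pairs_def)

lemma sum_mult_restrict:
  "(\<Sum>k\<in>A. t k * restrict f A k) = (\<Sum>k\<in>A. t k * f k :: 'b :: semiring_0)"
  by (rule sum.cong) auto

lemma hamiltonian_flip:
  "hamiltonian n w (flip k \<sigma>) = hamiltonian n w \<sigma> + 2 * local_field n w \<sigma> k"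
proof -
  have "hamiltonian n w (flip k \<sigma>) = (\<Sum>(i, j)\<in>index_pairs n.
      \<sigma> i * \<sigma> j * w i j - 2 * (if k = i \<or> k = j then \<sigma> i * \<sigma> j * w i j else 0))"
    unfolding hamiltonian_def
    by (rule sum.cong) (auto simp: flip_def index_pairs_def)
  then show ?thesis
    by (simp add: hamiltonian_def local_field_def case_prod_beta sum_subtractf sum_distrib_left)
qed

lemma locally_optimal_iff: "locally_optimal n w \<sigma> \<longleftrightarrow> (\<forall>k\<in>{1..n}. 0 \<le> local_field n w \<sigma> k)"
  by (simp add: locally_optimal_def hamiltonian_flip)

text \<open>The entry at (i, j) occurs in the fields of \<open>i\<close> and \<open>j\<close> only.
  This writes any linear combination of fields as a sum of independent terms.\<close>

lemma sum_mult_local_field: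
  "(\<Sum>k\<in>{1..n}. t k * local_field n w \<sigma> k) =
    (\<Sum>(i, j)\<in>index_pairs n. - (t i + t j) * (\<sigma> i * \<sigma> j) * w i j)"
proof -
  have "(\<Sum>k\<in>{1..n}. t k * local_field n w \<sigma> k) =
      (\<Sum>k\<in>{1..n}. \<Sum>(i, j)\<in>index_pairs n. if k = i \<or> k = j then - t k * (\<sigma> i * \<sigma> j * w i j) else 0)"
    by (simp add: local_field_def sum_distrib_left sum_negf[symmetric] case_prod_beta if_distrib cong: if_cong)
  also have "\<dots> = (\<Sum>(i, j)\<in>index_pairs n. \<Sum>k\<in>{1..n}. if k = i \<or> k = j then - t k * (\<sigma> i * \<sigma> j * w i j) else 0)"
    by (subst sum.swap) (simp add: case_prod_beta)
  also have "\<dots> = (\<Sum>(i, j)\<in>index_pairs n. - (t i + t j) * (\<sigma> i * \<sigma> j) * w i j)"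
  proof (rule sum.cong[OF refl], clarify)
    fix i j assume ij: "(i, j) \<in> index_pairs n"
    then have "{1..n} \<inter> {k. k = i \<or> k = j} = {i, j}" "i \<noteq> j"
      by (auto simp: index_pairs_def)
    then show "(\<Sum>k\<in>{1..n}. if k = i \<or> k = j then - t k * (\<sigma> i * \<sigma> j * w i j) else 0) =
        - (t i + t j) * (\<sigma> i * \<sigma> j) * w i j"
      by (simp add: sum.If_cases algebra_simps)
  qed
  finally show ?thesis .
qed

lemma sum_local_field: "(\<Sum>k\<in>{1..n}. local_field n w \<sigma> k) = - 2 * hamiltonian n w \<sigma>"
  using sum_mult_local_field[of "\<lambda>_. 1" n w \<sigma>]
  by (simp add: hamiltonian_def sum_distrib_left case_prod_beta mult.assoc)

section \<open>Covariance and Gaussian law of the local fields\<close>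

lemma index_pairs_Suc: "index_pairs (Suc n) = index_pairs n \<union> (\<lambda>i. (i, Suc n)) ` {1..n}"
  by (auto simp: index_pairs_def)

text \<open>The variance of the combination of fields with coefficients \<open>t\<close>. Each
  square occurs in n - 1 pairs, and one copy is spent on completing the cross terms to the square of
  the sum, leaving n - 2.\<close>

lemma sum_index_pairs_square:
  fixes t :: "nat \<Rightarrow> real"
  shows "(\<Sum>(i, j)\<in>index_pairs n. (t i + t j)\<^sup>2) =
    (real n - 2) * (\<Sum>k\<in>{1..n}. (t k)\<^sup>2) + (\<Sum>k\<in>{1..n}. t k)\<^sup>2"
proof (induction n)
  case 0
  have "index_pairs 0 = {}" by (auto simp: index_pairs_def)
  then show ?case by simp
next
  case (Suc n)
  have "(\<Sum>(i, j)\<in>index_pairs (Suc n). (t i + t j)\<^sup>2) =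
      (\<Sum>(i, j)\<in>index_pairs n. (t i + t j)\<^sup>2) + (\<Sum>i\<in>{1..n}. (t i + t (Suc n))\<^sup>2)"
  proof -
    have "index_pairs n \<inter> (\<lambda>i. (i, Suc n)) ` {1..n} = {}"
      by (auto simp: index_pairs_def)
    then show ?thesis
      unfolding index_pairs_Suc
      by (subst sum.union_disjoint) (auto simp: sum.reindex inj_on_def)
  qed
  also have "(\<Sum>i\<in>{1..n}. (t i + t (Suc n))\<^sup>2) =
      (\<Sum>i\<in>{1..n}. (t i)\<^sup>2) + real n * (t (Suc n))\<^sup>2 + 2 * (\<Sum>i\<in>{1..n}. t i) * t (Suc n)"
    by (simp add: power2_sum sum.distrib sum_distrib_left sum_distrib_right mult.assoc)
  finally show ?case
    unfolding Suc.IH by (simp add: power2_sum algebra_simps)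
qed

lemma char_local_field:
  assumes sk: "sk_disorder M n W" and \<sigma>: "\<sigma> \<in> spin_configs n"
  shows "(CLINT \<omega>|M. iexp (\<Sum>k\<in>{1..n}. t k * local_field n (\<lambda>i j. W i j \<omega>) \<sigma> k)) =
    complex_of_real (exp (- ((real n - 2) * (\<Sum>k\<in>{1..n}. (t k)\<^sup>2) + (\<Sum>k\<in>{1..n}. t k)\<^sup>2) / 2))"
proof -
  interpret prob_space M using sk by (simp add: sk_disorder_def)
  define a where "a = (\<lambda>(i, j). - (t i + t j) * (\<sigma> i * \<sigma> j))"
  define X where "X = (\<lambda>(i, j). W i j)"
  have distr: "distributed M lborel (X p) std_normal_density" if "p \<in> index_pairs n" for p
    using sk that by (auto simp: sk_disorder_def X_def)
  have indep: "indep_vars (\<lambda>_. borel) X (index_pairs n)"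
    using sk by (auto simp: sk_disorder_def X_def)
  have [measurable]: "X p \<in> borel_measurable M" if "p \<in> index_pairs n" for p
    using distributed_measurable[OF distr[OF that]] by simp
  have indep': "indep_vars (\<lambda>_. borel) (\<lambda>p \<omega>. iexp (a p * X p \<omega>)) (index_pairs n)"
    by (rule indep_vars_compose2[OF indep]) measurable
  \<comment> \<open>Here the spin configuration drops out: only the square of \<sigma> i * \<sigma>
    j enters the characteristic function, so the law of the fields is the same for every
    \<sigma>.\<close>
  have sq: "(a (i, j))\<^sup>2 = (t i + t j)\<^sup>2" if "(i, j) \<in> index_pairs n" for i j
  proof -
    have "i \<in> {1..n}" "j \<in> {1..n}" using that by (auto simp: index_pairs_def)
    with \<sigma> have "\<sigma> i \<in> {-1, 1}" "\<sigma> j \<in> {-1, 1}"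
      unfolding spin_configs_def by blast+
    then have "(\<sigma> i * \<sigma> j)\<^sup>2 = 1" by auto
    then show ?thesis
      by (simp only: a_def prod.case power_mult_distrib[of "- (t i + t j)"] power2_minus mult_1_right)
  qed
  have single: "(CLINT \<omega>|M. iexp (a p * X p \<omega>)) = complex_of_real (exp (- (a p)\<^sup>2 / 2))"
    if p: "p \<in> index_pairs n" for p
  proof -
    have "(CLINT \<omega>|M. iexp (a p * X p \<omega>)) = (CLINT x|distr M lborel (X p). iexp (a p * x))"
      using p by (subst integral_distr) auto
    also have "\<dots> = char std_normal_distribution (a p)"
      using distributed_distr_eq_density[OF distr[OF p]] by (simp add: char_def)
    finally show ?thesis by (simp add: char_std_normal_distribution)
  qed
  have "(CLINT \<omega>|M. iexp (\<Sum>k\<in>{1..n}. t k * local_field n (\<lambda>i j. W i j \<omega>) \<sigma> k)) =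
      (CLINT \<omega>|M. (\<Prod>p\<in>index_pairs n. iexp (a p * X p \<omega>)))"
    unfolding sum_mult_local_field
    by (simp add: exp_sum sum_distrib_left a_def X_def case_prod_beta)
  also have "\<dots> = (\<Prod>p\<in>index_pairs n. CLINT \<omega>|M. iexp (a p * X p \<omega>))"
    by (rule indep_vars_lebesgue_integral[OF finite_index_pairs indep'])
       (auto intro!: integrable_const_bound[where B = 1])
  also have "\<dots> = (\<Prod>p\<in>index_pairs n. complex_of_real (exp (- (a p)\<^sup>2 / 2)))"
    by (rule prod.cong) (simp_all only: single)
  also have "\<dots> = complex_of_real (exp (\<Sum>p\<in>index_pairs n. - (a p)\<^sup>2 / 2))"
    by (simp add: exp_sum)
  also have "(\<Sum>p\<in>index_pairs n. - (a p)\<^sup>2 / 2) = (\<Sum>(i, j)\<in>index_pairs n. - (t i + t j)\<^sup>2 / 2)"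
    by (rule sum.cong) (auto simp: sq)
  also have "\<dots> = - (\<Sum>(i, j)\<in>index_pairs n. (t i + t j)\<^sup>2) / 2"
    by (simp add: case_prod_beta sum_negf[symmetric] sum_divide_distrib)
  finally show ?thesis
    by (simp only: sum_index_pairs_square)
qed

text \<open>Coordinate 0 carries the shared component, coordinates 1 to n the individual ones.
  \<open>sqrt\<close> of a negative number is negative rather than undefined, so its square is n - 2
  only from n = 2 on.\<close>

definition field_law :: "nat \<Rightarrow> (nat \<Rightarrow> real) measure" where
  "field_law n = distr (PiM {0..n} (\<lambda>_. std_normal_distribution)) (PiM {1..n} (\<lambda>_. borel))
    (\<lambda>y. \<lambda>k\<in>{1..n}. sqrt (real n - 2) * y k + y 0)"

lemma measurable_field_law_map [measurable]:
  "(\<lambda>y. \<lambda>k\<in>{1..n}. sqrt (real n - 2) * y k + y 0)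
    \<in> measurable (PiM {0..n} (\<lambda>_. std_normal_distribution)) (PiM {1..n} (\<lambda>_. borel))"
proof -
  have [measurable]: "(\<lambda>y. y k) \<in> borel_measurable (PiM {0..n} (\<lambda>_. std_normal_distribution))"
    if "k \<in> {0..n}" for k
    using measurable_component_singleton[OF that, of "\<lambda>_. std_normal_distribution"]
    by (simp cong: measurable_cong_sets)
  show ?thesis by (intro measurable_restrict) auto
qed

lemma sets_field_law [measurable_cong, simp]: "sets (field_law n) = sets (PiM {1..n} (\<lambda>_. borel))"
  by (simp add: field_law_def)

lemma prob_space_field_law: "prob_space (field_law n)"
  unfolding field_law_def
  by (intro prob_space.prob_space_distr prob_space_PiM std_normal.prob_space_axioms measurable_field_law_map)

lemma char_field_law:
  assumes "2 \<le> n"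
  shows "(CLINT v|field_law n. iexp (\<Sum>k\<in>{1..n}. t k * v k)) =
    complex_of_real (exp (- ((real n - 2) * (\<Sum>k\<in>{1..n}. (t k)\<^sup>2) + (\<Sum>k\<in>{1..n}. t k)\<^sup>2) / 2))"
proof -
  let ?a = "sqrt (real n - 2)" and ?T = "PiM {0..n} (\<lambda>_. std_normal_distribution)"
  interpret T': product_sigma_finite "\<lambda>_. std_normal_distribution"
    by standard
  \<comment> \<open>Regrouping by independent coordinates: the shared one appears in every field and
    so collects the sum of all \<open>t k\<close>.\<close>
  define c where "c k = (if k = 0 then \<Sum>k\<in>{1..n}. t k else ?a * t k)" for k
  have split: "{0..n} = insert 0 {1..n}" by auto
  have "(CLINT v|field_law n. iexp (\<Sum>k\<in>{1..n}. t k * v k)) =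
      (CLINT y|?T. iexp (\<Sum>k\<in>{1..n}. t k * (?a * y k + y 0)))"
    unfolding field_law_def
    by (subst integral_distr[OF measurable_field_law_map]) ((auto)[1], simp only: sum_mult_restrict)
  also have "\<dots> = (CLINT y|?T. (\<Prod>k\<in>{0..n}. iexp (c k * y k)))"
  proof (rule Bochner_Integration.integral_cong[OF refl])
    fix y
    have "(\<Sum>k\<in>{1..n}. t k * (?a * y k + y 0)) = (\<Sum>k\<in>{0..n}. c k * y k)"
      unfolding split
      by (simp add: c_def sum.distrib sum_distrib_left sum_distrib_right algebra_simps)
    then show "iexp (\<Sum>k\<in>{1..n}. t k * (?a * y k + y 0)) = (\<Prod>k\<in>{0..n}. iexp (c k * y k))"
      by (simp add: exp_sum sum_distrib_left)
  qed
  also have "\<dots> = (\<Prod>k\<in>{0..n}. CLINT x|std_normal_distribution. iexp (c k * x))"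
    by (rule T'.product_integral_prod)
       (auto intro!: std_normal.integrable_const_bound[where B = 1])
  also have "\<dots> = (\<Prod>k\<in>{0..n}. complex_of_real (exp (- (c k)\<^sup>2 / 2)))"
    using char_std_normal_distribution by (simp add: char_def fun_eq_iff)
  also have "\<dots> = complex_of_real (exp (\<Sum>k\<in>{0..n}. - (c k)\<^sup>2 / 2))"
    by (simp add: exp_sum)
  also have "(\<Sum>k\<in>{0..n}. - (c k)\<^sup>2 / 2) =
      - ((real n - 2) * (\<Sum>k\<in>{1..n}. (t k)\<^sup>2) + (\<Sum>k\<in>{1..n}. t k)\<^sup>2) / 2"
  proof -
    have "(\<Sum>k\<in>{1..n}. (c k)\<^sup>2) = (\<Sum>k\<in>{1..n}. (real n - 2) * (t k)\<^sup>2)"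
      using assms by (intro sum.cong) (auto simp: c_def power_mult_distrib)
    also have "\<dots> = (real n - 2) * (\<Sum>k\<in>{1..n}. (t k)\<^sup>2)"
      by (rule sum_distrib_left[symmetric])
    finally have "(\<Sum>k\<in>{0..n}. (c k)\<^sup>2) = (real n - 2) * (\<Sum>k\<in>{1..n}. (t k)\<^sup>2) + (\<Sum>k\<in>{1..n}. t k)\<^sup>2"
      unfolding split by (simp add: c_def)
    moreover have "(\<Sum>k\<in>{0..n}. - (c k)\<^sup>2 / 2) = - (\<Sum>k\<in>{0..n}. (c k)\<^sup>2) / 2"
      by (simp add: sum_negf sum_divide_distrib)
    ultimately show ?thesis by (simp only:)
  qed
  finally show ?thesis .
qed

theorem distr_local_field:
  assumes sk: "sk_disorder M n W" and \<sigma>: "\<sigma> \<in> spin_configs n" and n: "2 \<le> n"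
  shows "(\<lambda>\<omega>. \<lambda>k\<in>{1..n}. local_field n (\<lambda>i j. W i j \<omega>) \<sigma> k) \<in> measurable M (PiM {1..n} (\<lambda>_. borel))"
      (is "?V \<in> _")
    and "distr M (PiM {1..n} (\<lambda>_. borel)) (\<lambda>\<omega>. \<lambda>k\<in>{1..n}. local_field n (\<lambda>i j. W i j \<omega>) \<sigma> k) = field_law n"
proof -
  interpret prob_space M using sk by (simp add: sk_disorder_def)
  have [measurable]: "W i j \<in> borel_measurable M" if "(i, j) \<in> index_pairs n" for i j
    using sk distributed_measurable[of M lborel "W i j" std_normal_density] that
    by (auto simp: sk_disorder_def)
  have [measurable]: "(\<lambda>\<omega>. local_field n (\<lambda>i j. W i j \<omega>) \<sigma> k) \<in> borel_measurable M" for k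
    unfolding local_field_def case_prod_beta
    by (intro borel_measurable_uminus borel_measurable_sum) auto
  show V [measurable]: "?V \<in> measurable M (PiM {1..n} (\<lambda>_. borel))"
    by (intro measurable_restrict) auto
  show "distr M (PiM {1..n} (\<lambda>_. borel)) ?V = field_law n"
  proof (rule measure_PiM_borel_eqI_char)
    show "prob_space (distr M (PiM {1..n} (\<lambda>_. borel)) ?V)" by (rule prob_space_distr) measurable
    show "prob_space (field_law n)" by (rule prob_space_field_law)
    fix t
    have "(CLINT v|distr M (PiM {1..n} (\<lambda>_. borel)) ?V. iexp (\<Sum>k\<in>{1..n}. t k * v k)) =
        (CLINT \<omega>|M. iexp (\<Sum>k\<in>{1..n}. t k * local_field n (\<lambda>i j. W i j \<omega>) \<sigma> k))"
      by (subst integral_distr[OF V]) ((auto)[1], simp only: sum_mult_restrict)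
    then show "(CLINT v|distr M (PiM {1..n} (\<lambda>_. borel)) ?V. iexp (\<Sum>k\<in>{1..n}. t k * v k)) =
        (CLINT v|field_law n. iexp (\<Sum>k\<in>{1..n}. t k * v k))"
      by (simp only: char_local_field[OF sk \<sigma>] char_field_law[OF n])
  qed auto
qed

text \<open>Both events depend on the fields alone, the Hamiltonian being minus half their sum. This
  moves every later estimate to \<open>field_law n\<close>.\<close>

lemma prob_locally_optimal_hamiltonian:
  assumes sk: "sk_disorder M n W" and \<sigma>: "\<sigma> \<in> spin_configs n" and n: "2 \<le> n"
    and B [measurable]: "B \<in> sets borel"
  shows "{\<omega> \<in> space M. locally_optimal n (\<lambda>i j. W i j \<omega>) \<sigma> \<and> hamiltonian n (\<lambda>i j. W i j \<omega>) \<sigma> \<in> B} \<in> sets M"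
    and "measure M {\<omega> \<in> space M. locally_optimal n (\<lambda>i j. W i j \<omega>) \<sigma> \<and> hamiltonian n (\<lambda>i j. W i j \<omega>) \<sigma> \<in> B} =
      measure (field_law n) {v \<in> space (field_law n). (\<forall>k\<in>{1..n}. 0 \<le> v k) \<and> - (\<Sum>k\<in>{1..n}. v k) / 2 \<in> B}"
proof -
  let ?S = "{v \<in> space (PiM {1..n} (\<lambda>_. borel)). (\<forall>k\<in>{1..n}. 0 \<le> v k) \<and> - (\<Sum>k\<in>{1..n}. v k) / 2 \<in> B}"
  let ?V = "\<lambda>\<omega>. \<lambda>k\<in>{1..n}. local_field n (\<lambda>i j. W i j \<omega>) \<sigma> k"
  note V = distr_local_field[OF sk \<sigma> n]
  have S: "?S \<in> sets (PiM {1..n} (\<lambda>_. borel :: real measure))" by measurable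
  have sp: "space (field_law n) = space (PiM {1..n} (\<lambda>_. borel))"
    by (rule sets_eq_imp_space_eq) simp
  have eq: "{\<omega> \<in> space M. locally_optimal n (\<lambda>i j. W i j \<omega>) \<sigma> \<and> hamiltonian n (\<lambda>i j. W i j \<omega>) \<sigma> \<in> B} =
      ?V -` ?S \<inter> space M"
  proof -
    have "- (\<Sum>k\<in>{1..n}. ?V \<omega> k) / 2 = hamiltonian n (\<lambda>i j. W i j \<omega>) \<sigma>" for \<omega>
      using sum_mult_restrict[of "\<lambda>_. 1 :: real" _ "{1..n}"] sum_local_field[of n "\<lambda>i j. W i j \<omega>" \<sigma>]
      by simp
    moreover have "(\<forall>k\<in>{1..n}. 0 \<le> ?V \<omega> k) \<longleftrightarrow> locally_optimal n (\<lambda>i j. W i j \<omega>) \<sigma>" for \<omega>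
      by (simp add: locally_optimal_iff)
    moreover have "?V \<omega> \<in> space (PiM {1..n} (\<lambda>_. borel))" for \<omega>
      by (simp add: space_PiM)
    ultimately show ?thesis
      by (intro set_eqI) (simp only: vimage_def Int_iff mem_Collect_eq simp_thms conj_ac)
  qed
  show "{\<omega> \<in> space M. locally_optimal n (\<lambda>i j. W i j \<omega>) \<sigma> \<and> hamiltonian n (\<lambda>i j. W i j \<omega>) \<sigma> \<in> B} \<in> sets M"
    unfolding eq by (rule measurable_sets[OF V(1) S])
  show "measure M {\<omega> \<in> space M. locally_optimal n (\<lambda>i j. W i j \<omega>) \<sigma> \<and> hamiltonian n (\<lambda>i j. W i j \<omega>) \<sigma> \<in> B} =
      measure (field_law n) {v \<in> space (field_law n). (\<forall>k\<in>{1..n}. 0 \<le> v k) \<and> - (\<Sum>k\<in>{1..n}. v k) / 2 \<in> B}"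
    using measure_distr[OF V(1) S] by (simp only: V(2) eq sp)
qed

section \<open>Exponential bounds for the local fields\<close>

text \<open>Once the shared coordinate is fixed at \<open>m\<close>, the fields are independent and
  identically distributed, so the product integrates to an n-th power.\<close>

lemma nn_integral_prod_field_law:
  assumes [measurable]: "h \<in> borel_measurable borel"
  shows "(\<integral>\<^sup>+v. (\<Prod>k\<in>{1..n}. h (v k)) \<partial>field_law n) =
    (\<integral>\<^sup>+m. (\<integral>\<^sup>+y. h (sqrt (real n - 2) * y + m) \<partial>std_normal_distribution) ^ n \<partial>std_normal_distribution)"
proof -
  let ?N = "\<lambda>_::nat. std_normal_distribution" and ?a = "sqrt (real n - 2)"
  interpret T: product_sigma_finite ?N by standard
  have split: "{0..n} = insert 0 {1..n}" by auto
  have [measurable]: "(\<lambda>y. y k) \<in> borel_measurable (PiM J ?N)" if "k \<in> J" for k J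
    using measurable_component_singleton[OF that, of "?N"]
    by (simp cong: measurable_cong_sets)
  have "(\<integral>\<^sup>+v. (\<Prod>k\<in>{1..n}. h (v k)) \<partial>field_law n) =
      (\<integral>\<^sup>+y. (\<Prod>k\<in>{1..n}. h (?a * y k + y 0)) \<partial>PiM (insert 0 {1..n}) ?N)"
    unfolding field_law_def
    by (subst nn_integral_distr[OF measurable_field_law_map]) (auto simp: split intro!: nn_integral_cong prod.cong)
  also have "\<dots> = (\<integral>\<^sup>+m. (\<integral>\<^sup>+x. (\<Prod>k\<in>{1..n}. h (?a * (x(0 := m)) k + (x(0 := m)) 0)) \<partial>PiM {1..n} ?N)
      \<partial>std_normal_distribution)"
    by (rule T.product_nn_integral_insert_rev) auto
  also have "\<dots> = (\<integral>\<^sup>+m. (\<integral>\<^sup>+x. (\<Prod>k\<in>{1..n}. h (?a * x k + m)) \<partial>PiM {1..n} ?N) \<partial>std_normal_distribution)"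
    by (intro nn_integral_cong prod.cong) auto
  also have "\<dots> = (\<integral>\<^sup>+m. (\<Prod>k\<in>{1..n}. \<integral>\<^sup>+y. h (?a * y + m) \<partial>std_normal_distribution) \<partial>std_normal_distribution)"
    by (intro nn_integral_cong T.product_nn_integral_prod) auto
  finally show ?thesis by simp
qed

lemma nn_integral_exp_local_field:
  assumes a: "0 < a"
  shows "(\<integral>\<^sup>+y. ennreal (exp (t / a * (a * y + m))) * indicator {0..} (a * y + m) \<partial>std_normal_distribution) =
    ennreal (exp (t * (m / a) + t\<^sup>2 / 2) * Phi (m / a + t))"
proof -
  have "(\<integral>\<^sup>+y. ennreal (exp (t / a * (a * y + m))) * indicator {0..} (a * y + m) \<partial>std_normal_distribution) =
      (\<integral>\<^sup>+y. ennreal (exp (t * (m / a))) * (ennreal (exp (t * y)) * indicator {- (m / a)..} y)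
        \<partial>std_normal_distribution)"
    using a
    by (intro nn_integral_cong)
       (auto simp: indicator_def field_simps exp_add ennreal_mult'[symmetric] simp flip: exp_add)
  also have "\<dots> = ennreal (exp (t * (m / a))) * ennreal (exp (t\<^sup>2 / 2) * Phi (m / a + t))"
    by (subst nn_integral_cmult) (auto simp: nn_integral_std_normal_exp_atLeast)
  finally show ?thesis
    by (simp add: ennreal_mult'[symmetric] exp_add mult.assoc)
qed

text \<open>With slope \<open>mills l = l\<close>, the tangent bounds the inner n-th power by an
  exponential linear in \<open>m\<close>, whose Gaussian integral is exact. The term
  \<open>3 * (t + l)^2\<close> pays for n - 2 in place of n.\<close>

lemma nn_integral_exp_field_law_le:
  assumes l: "mills l = l" and n: "3 \<le> n"
  shows "(\<integral>\<^sup>+v. (\<Prod>k\<in>{1..n}. ennreal (exp (t / sqrt (real n - 2) * v k)) * indicator {0..} (v k)) \<partial>field_law n)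
    \<le> ennreal (exp (real n * (ln (Phi l) - l\<^sup>2 / 2 + 2 * l * t + t\<^sup>2) + 3 * (t + l)\<^sup>2))"
proof -
  let ?a = "sqrt (real n - 2)"
  let ?C = "t\<^sup>2 / 2 + ln (Phi l) + l * t - l\<^sup>2"
  let ?s = "real n * (t + l) / ?a"
  have a: "0 < ?a" using n by simp
  have a2: "?a\<^sup>2 = real n - 2" using n by simp
  have inner: "(\<integral>\<^sup>+y. ennreal (exp (t / ?a * (?a * y + m))) * indicator {0..} (?a * y + m) \<partial>std_normal_distribution) ^ n
      \<le> ennreal (exp (real n * ?C)) * ennreal (exp (?s * m))" for m
  proof -
    have "exp (t * (m / ?a) + t\<^sup>2 / 2) * Phi (m / ?a + t) \<le>
        exp (t * (m / ?a) + t\<^sup>2 / 2) * (Phi l * exp (l * (m / ?a + t - l)))"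
      using Phi_le_exp_tangent[of "m / ?a + t" l] l by (intro mult_left_mono) auto
    also have "\<dots> = exp (t * (m / ?a) + t\<^sup>2 / 2 + ln (Phi l) + l * (m / ?a + t - l))"
      using Phi_pos[of l] by (simp add: exp_add)
    also have "t * (m / ?a) + t\<^sup>2 / 2 + ln (Phi l) + l * (m / ?a + t - l) = ?C + (t + l) / ?a * m"
      using a by (simp add: field_simps power2_eq_square)
    finally have "(exp (t * (m / ?a) + t\<^sup>2 / 2) * Phi (m / ?a + t)) ^ n \<le> exp (?C + (t + l) / ?a * m) ^ n"
      by (intro power_mono) (auto simp: Phi_nonneg)
    also have "\<dots> = exp (real n * ?C) * exp (?s * m)"
      by (simp add: exp_of_nat_mult[symmetric] exp_add[symmetric] distrib_left)
    finally show ?thesis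
      unfolding nn_integral_exp_local_field[OF a]
      by (simp add: ennreal_power Phi_nonneg ennreal_mult'[symmetric])
  qed
  have "(\<integral>\<^sup>+v. (\<Prod>k\<in>{1..n}. ennreal (exp (t / ?a * v k)) * indicator {0..} (v k)) \<partial>field_law n)
      \<le> (\<integral>\<^sup>+m. ennreal (exp (real n * ?C)) * ennreal (exp (?s * m)) \<partial>std_normal_distribution)"
    by (subst nn_integral_prod_field_law, (measurable)[1], intro nn_integral_mono inner)
  also have "\<dots> = ennreal (exp (real n * ?C + ?s\<^sup>2 / 2))"
    by (subst nn_integral_cmult, (measurable)[1], subst nn_integral_std_normal_exp)
       (simp add: ennreal_mult'[symmetric] exp_add)
  also have "\<dots> \<le> ennreal (exp (real n * (ln (Phi l) - l\<^sup>2 / 2 + 2 * l * t + t\<^sup>2) + 3 * (t + l)\<^sup>2))"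
  proof -
    \<comment> \<open>After multiplying out this reads 12 \<le> 4 n, so it holds exactly from n = 3
      on; half of the 6 becomes the factor 3.\<close>
    have "(real n)\<^sup>2 / (real n - 2) \<le> real n + 6"
      using n by (simp add: divide_le_eq power2_eq_square algebra_simps)
    then have "(t + l)\<^sup>2 * ((real n)\<^sup>2 / (real n - 2)) \<le> (t + l)\<^sup>2 * (real n + 6)"
      by (intro mult_left_mono) auto
    moreover have "?s\<^sup>2 = (t + l)\<^sup>2 * ((real n)\<^sup>2 / (real n - 2))"
      by (simp add: power_divide power_mult_distrib a2)
    ultimately have "?s\<^sup>2 \<le> (t + l)\<^sup>2 * (real n + 6)" by (simp only:)
    then have "?s\<^sup>2 / 2 \<le> (t + l)\<^sup>2 * (real n + 6) / 2" by (rule divide_right_mono) simp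
    moreover have "real n * ?C + (t + l)\<^sup>2 * (real n + 6) / 2 =
        real n * (ln (Phi l) - l\<^sup>2 / 2 + 2 * l * t + t\<^sup>2) + 3 * (t + l)\<^sup>2"
      by (simp add: power2_eq_square field_simps)
    ultimately have "real n * ?C + ?s\<^sup>2 / 2 \<le>
        real n * (ln (Phi l) - l\<^sup>2 / 2 + 2 * l * t + t\<^sup>2) + 3 * (t + l)\<^sup>2"
      by linarith
    then show ?thesis by simp
  qed
  finally show ?thesis .
qed

text \<open>Exponential Markov inequality restricted to the orthant. The parameter \<open>t\<close>
  may have either sign, so both tails of the sum are covered.\<close>

lemma prob_field_law_le:
  assumes l: "mills l = l" and n: "3 \<le> n"
    and Q: "\<And>v. Q v \<Longrightarrow> (\<forall>k\<in>{1..n}. 0 \<le> v k) \<and> c \<le> t / sqrt (real n - 2) * (\<Sum>k\<in>{1..n}. v k)"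
  shows "measure (field_law n) {v \<in> space (field_law n). Q v} \<le>
    exp (real n * (ln (Phi l) - l\<^sup>2 / 2 + 2 * l * t + t\<^sup>2) + 3 * (t + l)\<^sup>2 - c)"
proof (cases "{v \<in> space (field_law n). Q v} \<in> sets (field_law n)")
  \<comment> \<open>\<open>measure\<close> is 0 on a non-measurable set, so the bound is trivial
    there.\<close>
  case False
  then show ?thesis by (simp add: measure_notin_sets)
next
  case True
  interpret prob_space "field_law n" by (rule prob_space_field_law)
  let ?a = "sqrt (real n - 2)"
  let ?f = "\<lambda>v. \<Prod>k\<in>{1..n}. ennreal (exp (t / ?a * v k)) * indicator {0..} (v k)"
  have "emeasure (field_law n) {v \<in> space (field_law n). Q v} =
      (\<integral>\<^sup>+v. indicator {v \<in> space (field_law n). Q v} v \<partial>field_law n)"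
    using True by simp
  also have "\<dots> \<le> (\<integral>\<^sup>+v. ennreal (exp (- c)) * ?f v \<partial>field_law n)"
  proof (intro nn_integral_mono)
    fix v
    show "indicator {v \<in> space (field_law n). Q v} v \<le> ennreal (exp (- c)) * ?f v"
    proof (cases "Q v")
      case True
      have "?f v = (\<Prod>k\<in>{1..n}. ennreal (exp (t / ?a * v k)))"
        using Q[OF True] by (intro prod.cong) auto
      also have "\<dots> = ennreal (exp (t / ?a * (\<Sum>k\<in>{1..n}. v k)))"
        by (simp add: prod_ennreal exp_sum[symmetric] sum_distrib_left)
      finally have "ennreal (exp (- c)) * ?f v = ennreal (exp (t / ?a * (\<Sum>k\<in>{1..n}. v k) - c))"
        by (simp add: ennreal_mult'[symmetric] exp_add[symmetric])
      moreover have "1 \<le> exp (t / ?a * (\<Sum>k\<in>{1..n}. v k) - c)"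
        using Q[OF True] by simp
      ultimately show ?thesis
        by (simp add: indicator_def del: one_le_exp_iff)
    qed simp
  qed
  also have "\<dots> = ennreal (exp (- c)) * (\<integral>\<^sup>+v. ?f v \<partial>field_law n)"
    by (subst nn_integral_cmult) auto
  also have "\<dots> \<le> ennreal (exp (- c)) *
      ennreal (exp (real n * (ln (Phi l) - l\<^sup>2 / 2 + 2 * l * t + t\<^sup>2) + 3 * (t + l)\<^sup>2))"
    by (intro mult_left_mono nn_integral_exp_field_law_le l n) auto
  also have "\<dots> = ennreal (exp (real n * (ln (Phi l) - l\<^sup>2 / 2 + 2 * l * t + t\<^sup>2) + 3 * (t + l)\<^sup>2 - c))"
    by (simp add: ennreal_mult'[symmetric] exp_add[symmetric])
  finally show ?thesis
    by (simp add: emeasure_eq_measure)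
qed

lemma prob_field_law_nonneg_ge:
  assumes l: "0 < l" and n: "3 \<le> n"
  shows "exp (real n * (ln (Phi l) - l\<^sup>2 / 2) - l * sqrt (real n) - 1 / 2 - ln (sqrt (2 * pi))) \<le>
    measure (field_law n) {v \<in> space (field_law n). \<forall>k\<in>{1..n}. 0 \<le> v k}"
proof -
  interpret prob_space "field_law n" by (rule prob_space_field_law)
  let ?a = "sqrt (real n - 2)"
  have a: "0 < ?a" using n by simp
  have a2: "?a\<^sup>2 = real n - 2" using n by simp
  \<comment> \<open>The density at the far end of the window, hence its minimum there. Half the
    cross term of (a l + 1)^2 is a l, at most l sqrt n: the whole price of the window at that
    order.\<close>
  let ?d = "std_normal_density (?a * l + 1)"
  have "?a * l \<le> l * sqrt (real n)"
    using l by (subst mult.commute, intro mult_left_mono) auto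
  moreover have "(?a * l + 1)\<^sup>2 = real n * l\<^sup>2 - 2 * l\<^sup>2 + 2 * (?a * l) + 1"
    by (simp add: power2_sum power_mult_distrib a2 left_diff_distrib)
  moreover have "0 \<le> l\<^sup>2" by simp
  ultimately have "(?a * l + 1)\<^sup>2 / 2 \<le> real n * l\<^sup>2 / 2 + l * sqrt (real n) + 1 / 2"
    by (simp only: diff_divide_distrib add_divide_distrib)
  then have "exp (real n * (ln (Phi l) - l\<^sup>2 / 2) - l * sqrt (real n) - 1 / 2 - ln (sqrt (2 * pi))) \<le>
      exp (real n * ln (Phi l) - (?a * l + 1)\<^sup>2 / 2 - ln (sqrt (2 * pi)))"
    by (simp add: right_diff_distrib)
  also have "\<dots> = exp (real n * ln (Phi l)) * exp (- (?a * l + 1)\<^sup>2 / 2) * exp (- ln (sqrt (2 * pi)))"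
    by (simp add: exp_add[symmetric])
  also have "\<dots> = Phi l ^ n * ?d"
    using Phi_pos[of l] by (simp add: exp_of_nat_mult std_normal_density_def exp_minus field_simps)
  finally have low: "exp (real n * (ln (Phi l) - l\<^sup>2 / 2) - l * sqrt (real n) - 1 / 2 - ln (sqrt (2 * pi))) \<le> Phi l ^ n * ?d" .
  have "ennreal (Phi l ^ n * ?d) = (\<integral>\<^sup>+m. ennreal (Phi l ^ n * ?d) * indicator {?a * l..?a * l + 1} m \<partial>lborel)"
    by (simp add: nn_integral_cmult)
  also have "\<dots> \<le> (\<integral>\<^sup>+m. ennreal (std_normal_density m) * ennreal (Phi (m / ?a) ^ n) \<partial>lborel)"
  proof (intro nn_integral_mono)
    fix m
    show "ennreal (Phi l ^ n * ?d) * indicator {?a * l..?a * l + 1} m \<le>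
        ennreal (std_normal_density m) * ennreal (Phi (m / ?a) ^ n)"
    proof (cases "m \<in> {?a * l..?a * l + 1}")
      case True
      have "0 \<le> ?a * l" using a l by simp
      then have "m\<^sup>2 \<le> (?a * l + 1)\<^sup>2"
        using True by (intro power_mono) auto
      then have "?d \<le> std_normal_density m"
        by (simp add: std_normal_density_def divide_right_mono)
      moreover have "Phi l \<le> Phi (m / ?a)"
        using True a by (intro Phi_mono) (simp add: field_simps)
      ultimately have "Phi l ^ n * ?d \<le> std_normal_density m * Phi (m / ?a) ^ n"
        by (subst mult.commute, intro mult_mono power_mono) (auto simp: Phi_nonneg)
      then show ?thesis
        using True by (simp add: ennreal_mult'[symmetric] ennreal_leI)
    qed simp
  qed
  also have "\<dots> = (\<integral>\<^sup>+m. ennreal (Phi (m / ?a) ^ n) \<partial>std_normal_distribution)"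
  proof -
    have [measurable]: "Phi \<in> borel_measurable borel"
      by (rule borel_measurable_mono) (simp add: mono_def Phi_mono)
    show ?thesis by (subst nn_integral_density) auto
  qed
  also have "\<dots> = (\<integral>\<^sup>+m. (\<integral>\<^sup>+y. indicator {0..} (?a * y + m) \<partial>std_normal_distribution) ^ n \<partial>std_normal_distribution)"
    using nn_integral_exp_local_field[OF a, of 0] by (simp add: ennreal_power Phi_nonneg)
  also have "\<dots> = (\<integral>\<^sup>+v. (\<Prod>k\<in>{1..n}. indicator {0..} (v k)) \<partial>field_law n)"
    by (rule nn_integral_prod_field_law[symmetric]) simp
  also have "\<dots> = (\<integral>\<^sup>+v. indicator {v \<in> space (field_law n). \<forall>k\<in>{1..n}. 0 \<le> v k} v \<partial>field_law n)"
    by (intro nn_integral_cong) (auto simp: indicator_def)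
  also have "\<dots> = ennreal (measure (field_law n) {v \<in> space (field_law n). \<forall>k\<in>{1..n}. 0 \<le> v k})"
  proof -
    have [measurable]: "(\<lambda>v. v k) \<in> borel_measurable (field_law n)" if "k \<in> {1..n}" for k
      by (rule borel_measurable_component_of_sets[OF sets_field_law that])
    have "{v \<in> space (field_law n). \<forall>k\<in>{1..n}. 0 \<le> v k} \<in> events" by measurable
    then show ?thesis by (subst nn_integral_indicator) (simp_all only: emeasure_eq_measure)
  qed
  finally have "Phi l ^ n * ?d \<le> measure (field_law n) {v \<in> space (field_law n). \<forall>k\<in>{1..n}. 0 \<le> v k}"
    by simp
  with low show ?thesis by simp
qed

section \<open>Local optimality and the Hamiltonian\<close>

text \<open>The two bounds share the rate \<open>ln (Phi l) - l^2 / 2\<close> and differ by a factor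
  exp (O(sqrt n)), which disappears after taking logarithms and dividing by n.\<close>

lemma
  assumes l: "mills l = l" "0 < l" and sk: "sk_disorder M n W" and \<sigma>: "\<sigma> \<in> spin_configs n" and n: "3 \<le> n"
  defines "p \<equiv> \<P>(\<omega> in M. locally_optimal n (\<lambda>i j. W i j \<omega>) \<sigma>)"
  shows prob_locally_optimal_le: "p \<le> exp (real n * (ln (Phi l) - l\<^sup>2 / 2) + 3 * l\<^sup>2)"
    and prob_locally_optimal_ge:
      "exp (real n * (ln (Phi l) - l\<^sup>2 / 2) - l * sqrt (real n) - 1 / 2 - ln (sqrt (2 * pi))) \<le> p"
proof -
  have p: "p = measure (field_law n) {v \<in> space (field_law n). \<forall>k\<in>{1..n}. 0 \<le> v k}"
    using prob_locally_optimal_hamiltonian(2)[OF sk \<sigma>, of UNIV] n by (simp add: p_def)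
  show "p \<le> exp (real n * (ln (Phi l) - l\<^sup>2 / 2) + 3 * l\<^sup>2)"
    unfolding p using prob_field_law_le[OF l(1) n, of "\<lambda>v. \<forall>k\<in>{1..n}. 0 \<le> v k" 0 0] by simp
  show "exp (real n * (ln (Phi l) - l\<^sup>2 / 2) - l * sqrt (real n) - 1 / 2 - ln (sqrt (2 * pi))) \<le> p"
    unfolding p by (rule prob_field_law_nonneg_ge[OF l(2) n])
qed

section \<open>Concentration of the Hamiltonian under local optimality\<close>

lemma powr_minus_three_halves:
  assumes "0 < n"
  shows "real n powr (- 3 / 2) = 1 / (real n * sqrt (real n))"
proof -
  have "real n powr (- 3 / 2) = real n powr (- (1 + 1 / 2))" by simp
  also have "\<dots> = 1 / (real n * sqrt (real n))"
    using assms by (simp only: powr_minus powr_add powr_half_sqrt) (simp add: divide_inverse)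
  finally show ?thesis .
qed

text \<open>For the lower tail of the Hamiltonian the exponent per site is t^2 - 2 t e beyond the
  rate, minimal at t = e; for the upper tail it is t^2 + 2 t e, minimal at t = - e. Since e < l, the
  remaining bounded terms are at most 12 l^2, uniformly in e.\<close>

lemma
  assumes l: "mills l = l" and sk: "sk_disorder M n W" and \<sigma>: "\<sigma> \<in> spin_configs n" and n: "3 \<le> n"
    and e: "0 < e" "e < l"
  shows prob_hamiltonian_less:
      "\<P>(\<omega> in M. locally_optimal n (\<lambda>i j. W i j \<omega>) \<sigma> \<and>
          hamiltonian n (\<lambda>i j. W i j \<omega>) \<sigma> < - (l + e) * (real n * sqrt (real n)))
        \<le> exp (real n * (ln (Phi l) - l\<^sup>2 / 2 - e\<^sup>2) + 12 * l\<^sup>2)" (is ?lower)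
    and prob_hamiltonian_greater:
      "\<P>(\<omega> in M. locally_optimal n (\<lambda>i j. W i j \<omega>) \<sigma> \<and>
          - (l - e) * (real n * sqrt (real n)) < hamiltonian n (\<lambda>i j. W i j \<omega>) \<sigma>)
        \<le> exp (real n * (ln (Phi l) - l\<^sup>2 / 2 - e\<^sup>2) + 12 * l\<^sup>2)" (is ?upper)
proof -
  let ?a = "sqrt (real n - 2)" and ?N = "real n * sqrt (real n)" and ?g = "ln (Phi l) - l\<^sup>2 / 2"
  have a: "0 < ?a" using n by simp
  note P = prob_locally_optimal_hamiltonian(2)[OF sk \<sigma>]
  have ll: "e * e \<le> l * l" "e * l \<le> l * l" using e by (auto intro!: mult_mono)
  have "measure (field_law n) {v \<in> space (field_law n).
      (\<forall>k\<in>{1..n}. 0 \<le> v k) \<and> - (\<Sum>k\<in>{1..n}. v k) / 2 \<in> {..< - (l + e) * ?N}} \<le>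
      exp (real n * (?g + 2 * l * e + e\<^sup>2) + 3 * (e + l)\<^sup>2 - 2 * real n * e * (l + e))"
  proof (rule prob_field_law_le[OF l n])
    fix v :: "nat \<Rightarrow> real"
    assume v: "(\<forall>k\<in>{1..n}. 0 \<le> v k) \<and> - (\<Sum>k\<in>{1..n}. v k) / 2 \<in> {..< - (l + e) * ?N}"
    have S: "2 * (l + e) * ?N \<le> (\<Sum>k\<in>{1..n}. v k)"
      using v by (simp only: lessThan_iff mult_minus_left) linarith
    have "2 * real n * e * (l + e) = e / ?a * (2 * (l + e) * (real n * ?a))"
      using a by simp
    also have "\<dots> \<le> e / ?a * (2 * (l + e) * ?N)"
      using a e by (intro mult_left_mono) auto
    also have "\<dots> \<le> e / ?a * (\<Sum>k\<in>{1..n}. v k)"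
      using a e S by (intro mult_left_mono) auto
    finally show "(\<forall>k\<in>{1..n}. 0 \<le> v k) \<and> 2 * real n * e * (l + e) \<le> e / ?a * (\<Sum>k\<in>{1..n}. v k)"
      using v by simp
  qed
  also have "\<dots> \<le> exp (real n * (?g - e\<^sup>2) + 12 * l\<^sup>2)"
    using ll by (simp add: power2_eq_square algebra_simps)
  finally show ?lower
    using P[of "{..< - (l + e) * ?N}"] n by simp
  have "measure (field_law n) {v \<in> space (field_law n).
      (\<forall>k\<in>{1..n}. 0 \<le> v k) \<and> - (\<Sum>k\<in>{1..n}. v k) / 2 \<in> {- (l - e) * ?N <..}} \<le>
      exp (real n * (?g + 2 * l * (- e) + (- e)\<^sup>2) + 3 * (- e + l)\<^sup>2 - (- 2 * (real n + 3) * e * (l - e)))"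
  proof (rule prob_field_law_le[OF l n])
    fix v :: "nat \<Rightarrow> real"
    assume v: "(\<forall>k\<in>{1..n}. 0 \<le> v k) \<and> - (\<Sum>k\<in>{1..n}. v k) / 2 \<in> {- (l - e) * ?N <..}"
    \<comment> \<open>With negative \<open>t\<close> an upper bound on the field sum is needed, and
      sqrt n exceeds sqrt (n - 2); raising n to n + 3 compensates from n = 3 on. The resulting extra
      \<open>6 * e * (l - e)\<close> is also covered by 12 l^2.\<close>
    have "?N \<le> (real n + 3) * ?a"
    proof (rule power2_le_imp_le)
      have "3 * real n \<le> real n * real n" using n by (intro mult_right_mono) auto
      then have "real n * 3 + 18 \<le> real n * (real n * 4)" using n by linarith
      then show "?N\<^sup>2 \<le> ((real n + 3) * ?a)\<^sup>2"
        using n by (simp add: power_mult_distrib) (simp add: power2_eq_square algebra_simps)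
    qed (use n in auto)
    then have "(l - e) * ?N \<le> (l - e) * ((real n + 3) * ?a)"
      using e by (intro mult_left_mono) auto
    with v have S: "(\<Sum>k\<in>{1..n}. v k) \<le> 2 * ((l - e) * ((real n + 3) * ?a))"
      by (simp only: greaterThan_iff mult_minus_left) linarith
    have "- 2 * (real n + 3) * e * (l - e) = - e / ?a * (2 * ((l - e) * ((real n + 3) * ?a)))"
      using a by (simp add: algebra_simps)
    also have "\<dots> \<le> - e / ?a * (\<Sum>k\<in>{1..n}. v k)"
      using S a e by (intro mult_left_mono_neg) auto
    finally show "(\<forall>k\<in>{1..n}. 0 \<le> v k) \<and> - 2 * (real n + 3) * e * (l - e) \<le> - e / ?a * (\<Sum>k\<in>{1..n}. v k)"
      using v by simp
  qed
  also have "\<dots> \<le> exp (real n * (?g - e\<^sup>2) + 12 * l\<^sup>2)"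
    using ll by (simp add: power2_eq_square algebra_simps)
  finally show ?upper
    using P[of "{- (l - e) * ?N <..}"] n by simp
qed

text \<open>The two tails are divided by the lower bound for local optimality. The rates cancel,
  leaving exp (- e^2 n) times the window loss exp (l sqrt n) and constants; ln 2 counts the two
  tails.\<close>

lemma cond_prob_hamiltonian_ge:
  assumes l: "mills l = l" "0 < l" and sk: "sk_disorder M n W" and \<sigma>: "\<sigma> \<in> spin_configs n" and n: "3 \<le> n"
    and e: "0 < e" "e < l"
  shows "1 - exp ((l + 1 / 2 + ln (sqrt (2 * pi)) + ln 2 + 12 * l\<^sup>2) * sqrt (real n) - e\<^sup>2 * real n) \<le>
    \<P>(\<omega> in M.
         - l - e \<le> real n powr (- 3 / 2) * hamiltonian n (\<lambda>i j. W i j \<omega>) \<sigma> \<and>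
         real n powr (- 3 / 2) * hamiltonian n (\<lambda>i j. W i j \<omega>) \<sigma> \<le> - l + e
       \<bar> locally_optimal n (\<lambda>i j. W i j \<omega>) \<sigma>)"
proof -
  interpret prob_space M using sk by (simp add: sk_disorder_def)
  let ?N = "real n * sqrt (real n)" and ?g = "ln (Phi l) - l\<^sup>2 / 2"
  let ?H = "\<lambda>\<omega>. hamiltonian n (\<lambda>i j. W i j \<omega>) \<sigma>" and ?opt = "\<lambda>\<omega>. locally_optimal n (\<lambda>i j. W i j \<omega>) \<sigma>"
  let ?c = "1 / 2 + ln (sqrt (2 * pi)) + ln 2 + 12 * l\<^sup>2"
  define p where "p = \<P>(\<omega> in M. ?opt \<omega>)"
  define good where "good = \<P>(\<omega> in M. ?opt \<omega> \<and> ?H \<omega> \<in> {- (l + e) * ?N..- (l - e) * ?N})"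
  define E where "E = exp (real n * (?g - e\<^sup>2) + 12 * l\<^sup>2)"
  have N: "0 < ?N" using n by simp
  have p_ge: "exp (real n * ?g - l * sqrt (real n) - 1 / 2 - ln (sqrt (2 * pi))) \<le> p"
    unfolding p_def by (rule prob_locally_optimal_ge[OF l sk \<sigma> n])
  have p_pos: "0 < p" by (rule less_le_trans[OF exp_gt_zero p_ge])
  have sets: "{\<omega> \<in> space M. ?opt \<omega> \<and> ?H \<omega> \<in> B} \<in> events" if "B \<in> sets borel" for B
    using prob_locally_optimal_hamiltonian(1)[OF sk \<sigma> _ that] n by simp
  have "p \<le> good + \<P>(\<omega> in M. ?opt \<omega> \<and> ?H \<omega> \<in> {..< - (l + e) * ?N}) +
      \<P>(\<omega> in M. ?opt \<omega> \<and> ?H \<omega> \<in> {- (l - e) * ?N <..})"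
  proof -
    have "p \<le> prob ({\<omega> \<in> space M. ?opt \<omega> \<and> ?H \<omega> \<in> {- (l + e) * ?N..- (l - e) * ?N}} \<union>
        {\<omega> \<in> space M. ?opt \<omega> \<and> ?H \<omega> \<in> {..< - (l + e) * ?N}} \<union>
        {\<omega> \<in> space M. ?opt \<omega> \<and> ?H \<omega> \<in> {- (l - e) * ?N <..}})"
      unfolding p_def by (intro finite_measure_mono sets.Un sets) auto
    also have "\<dots> \<le> prob ({\<omega> \<in> space M. ?opt \<omega> \<and> ?H \<omega> \<in> {- (l + e) * ?N..- (l - e) * ?N}} \<union>
        {\<omega> \<in> space M. ?opt \<omega> \<and> ?H \<omega> \<in> {..< - (l + e) * ?N}}) +
        \<P>(\<omega> in M. ?opt \<omega> \<and> ?H \<omega> \<in> {- (l - e) * ?N <..})"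
      by (intro measure_Un_le sets.Un sets) auto
    also have "\<dots> \<le> good + \<P>(\<omega> in M. ?opt \<omega> \<and> ?H \<omega> \<in> {..< - (l + e) * ?N}) +
        \<P>(\<omega> in M. ?opt \<omega> \<and> ?H \<omega> \<in> {- (l - e) * ?N <..})"
      unfolding good_def by (intro add_right_mono measure_Un_le sets) auto
    finally show ?thesis .
  qed
  also have "\<dots> \<le> good + E + E"
    using prob_hamiltonian_less[OF l(1) sk \<sigma> n e] prob_hamiltonian_greater[OF l(1) sk \<sigma> n e]
    unfolding E_def by simp
  finally have "p - 2 * E \<le> good" by simp
  then have "1 - 2 * E / p \<le> good / p"
    using divide_right_mono[of "p - 2 * E" good p] p_pos by (simp add: diff_divide_distrib)
  moreover have "2 * E / p \<le> exp ((l + ?c) * sqrt (real n) - e\<^sup>2 * real n)"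
  proof -
    have "0 \<le> ?c" using pi_gt3 by simp
    \<comment> \<open>Since sqrt n is at least 1, the nonnegative constant \<open>?c\<close> can be
      absorbed into the coefficient of sqrt n.\<close>
    then have "?c * 1 \<le> ?c * sqrt (real n)" using n by (intro mult_left_mono) auto
    then have c: "l * sqrt (real n) + ?c \<le> (l + ?c) * sqrt (real n)"
      by (simp add: distrib_right)
    have "2 * E / p \<le> 2 * E / exp (real n * ?g - l * sqrt (real n) - 1 / 2 - ln (sqrt (2 * pi)))"
      using p_ge by (intro divide_left_mono) (auto simp: E_def p_pos)
    also have "\<dots> = exp (ln 2) * E / exp (real n * ?g - l * sqrt (real n) - 1 / 2 - ln (sqrt (2 * pi)))"
      by simp
    also have "\<dots> = exp (l * sqrt (real n) + ?c - e\<^sup>2 * real n)"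
      unfolding E_def exp_add[symmetric] exp_diff[symmetric]
      by (rule arg_cong[where f = exp]) (simp add: algebra_simps)
    also have "\<dots> \<le> exp ((l + ?c) * sqrt (real n) - e\<^sup>2 * real n)"
      using c by simp
    finally show ?thesis .
  qed
  moreover have "\<P>(\<omega> in M. - l - e \<le> real n powr (- 3 / 2) * ?H \<omega> \<and> real n powr (- 3 / 2) * ?H \<omega> \<le> - l + e
      \<bar> ?opt \<omega>) = good / p"
  proof -
    have "- l - e \<le> real n powr (- 3 / 2) * h \<and> real n powr (- 3 / 2) * h \<le> - l + e \<longleftrightarrow>
        h \<in> {- (l + e) * ?N..- (l - e) * ?N}" for h
    proof -
      have "real n powr (- 3 / 2) * h = h / ?N"
        using n by (subst powr_minus_three_halves) auto
      then show ?thesis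
        by (simp only: pos_le_divide_eq[OF N] pos_divide_le_eq[OF N] atLeastAtMost_iff) simp
    qed
    then show ?thesis
      by (simp only: cond_prob_def good_def p_def conj_commute)
  qed
  ultimately show ?thesis by (simp add: add.assoc)
qed

theorem theorem1:
  shows "(\<forall>(M :: nat \<Rightarrow> 'a measure) W \<sigma>.
            (\<forall>n. sk_disorder (M n) n (W n)) \<and> (\<forall>n. \<sigma> n \<in> spin_configs n) \<longrightarrow>
            (\<lambda>n. (1 / real n) *
                 ln (\<P>(\<omega> in M n. locally_optimal n (\<lambda>i j. W n i j \<omega>) (\<sigma> n))))
              \<longlonglongrightarrow> alpha_star - ln 2)
       \<and> (\<exists>\<epsilon>\<^sub>0 > 0. \<exists>L > 0. \<exists>n\<^sub>0 :: nat.
            \<forall>\<epsilon> :: real. 0 < \<epsilon> \<and> \<epsilon> < \<epsilon>\<^sub>0 \<longrightarrow>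
            (\<forall>n \<ge> n\<^sub>0. \<forall>(M :: 'a measure) W. sk_disorder M n W \<longrightarrow>
            (\<forall>\<sigma> \<in> spin_configs n.
               \<P>(\<omega> in M.
                   - v_star / 2 - \<epsilon> \<le> real n powr (- 3 / 2) * hamiltonian n (\<lambda>i j. W i j \<omega>) \<sigma> \<and>
                   real n powr (- 3 / 2) * hamiltonian n (\<lambda>i j. W i j \<omega>) \<sigma> \<le> - v_star / 2 + \<epsilon>
                 \<bar> locally_optimal n (\<lambda>i j. W i j \<omega>) \<sigma>)
               \<ge> 1 - exp (L * sqrt (real n) - \<epsilon>\<^sup>2 * real n))))"
proof -
  obtain l where l: "mills l = l" "0 < l" "mills 0 \<le> 2 * l"
    by (rule mills_fixed_point)
  let ?g = "ln (Phi l) - l\<^sup>2 / 2" and ?c = "1 / 2 + ln (sqrt (2 * pi))"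
  have v: "- v_star / 2 = - l" and \<alpha>: "alpha_star - ln 2 = ?g"
    using v_star_alpha_star_at_fixed_point[OF l] by simp_all
  have "(\<lambda>n. (1 / real n) * ln (\<P>(\<omega> in M n. locally_optimal n (\<lambda>i j. W n i j \<omega>) (\<sigma> n))))
      \<longlonglongrightarrow> alpha_star - ln 2"
    if "\<forall>n. sk_disorder (M n) n (W n)" and "\<forall>n. \<sigma> n \<in> spin_configs n"
    for M :: "nat \<Rightarrow> 'a measure" and W \<sigma>
  proof -
    define p where "p n = \<P>(\<omega> in M n. locally_optimal n (\<lambda>i j. W n i j \<omega>) (\<sigma> n))" for n
    have upper: "(1 / real n) * ln (p n) \<le> ?g + 3 * l\<^sup>2 / real n"
      and lower: "?g - l / sqrt (real n) - ?c / real n \<le> (1 / real n) * ln (p n)" if n: "3 \<le> n" for n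
    proof -
      have le: "p n \<le> exp (real n * ?g + 3 * l\<^sup>2)"
        and ge: "exp (real n * ?g - l * sqrt (real n) - 1 / 2 - ln (sqrt (2 * pi))) \<le> p n"
        unfolding p_def
        using that \<open>\<forall>n. sk_disorder (M n) n (W n)\<close> \<open>\<forall>n. \<sigma> n \<in> spin_configs n\<close>
        by (auto intro!: prob_locally_optimal_le prob_locally_optimal_ge l)
      have "0 < p n" by (rule less_le_trans[OF exp_gt_zero ge])
      have "ln (p n) \<le> real n * ?g + 3 * l\<^sup>2"
        using le \<open>0 < p n\<close> by (metis ln_exp ln_mono)
      then have "(1 / real n) * ln (p n) \<le> (1 / real n) * (real n * ?g + 3 * l\<^sup>2)"
        by (intro mult_left_mono) auto
      also have "\<dots> = ?g + 3 * l\<^sup>2 / real n" using n by (simp add: field_simps)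
      finally show "(1 / real n) * ln (p n) \<le> ?g + 3 * l\<^sup>2 / real n" .
      have "real n * ?g - l * sqrt (real n) - ?c \<le> ln (p n)"
        using ln_mono[OF ge exp_gt_zero] unfolding ln_exp by linarith
      then have "(1 / real n) * (real n * ?g - l * sqrt (real n) - ?c) \<le> (1 / real n) * ln (p n)"
        by (intro mult_left_mono) auto
      moreover have "(1 / real n) * (real n * ?g - l * sqrt (real n) - ?c) =
          ?g - l * (sqrt (real n) / real n) - ?c / real n"
        using n by (simp add: field_simps)
      moreover have "sqrt (real n) / real n = 1 / sqrt (real n)"
        using n by (simp add: field_simps)
      ultimately show "?g - l / sqrt (real n) - ?c / real n \<le> (1 / real n) * ln (p n)" by simp
    qed
    have "(\<lambda>n. (1 / real n) * ln (p n)) \<longlonglongrightarrow> ?g"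
    proof (rule tendsto_sandwich)
      show "(\<lambda>n. ?g - l / sqrt (real n) - ?c / real n) \<longlonglongrightarrow> ?g" by real_asymp
      show "(\<lambda>n. ?g + 3 * l\<^sup>2 / real n) \<longlonglongrightarrow> ?g" by real_asymp
    qed (use lower upper in \<open>auto intro!: eventually_sequentiallyI[of 3]\<close>)
    then show ?thesis by (simp only: p_def \<alpha>)
  qed
  moreover have "0 < l + 1 / 2 + ln (sqrt (2 * pi)) + ln 2 + 12 * l\<^sup>2"
    using l(2) pi_gt3 by (intro add_pos_nonneg) auto
  \<comment> \<open>Witnesses: \<open>l\<close> for the bound on \<epsilon>, 3 for the threshold on
    n, and for L the coefficient of \<open>sqrt (real n)\<close> in
    \<open>cond_prob_hamiltonian_ge\<close>, just shown positive.\<close>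
  ultimately show ?thesis
    unfolding v using cond_prob_hamiltonian_ge[OF l(1,2)] l(2) by blast
qed

end
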